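(* Let $u\in H^1_{loc}(\Omega)\cap C(\Omega)$ be an $\mathcal L_{1/4}$-subharmonic function in $\Omega$ such that $$\limsup_{d(x)\to0}\frac{u(x)}{d^{\frac12}(x)|\log d(x)|}\le0 .$$ Then $u\le0$ in $\Omega$.
   Context: $\Omega\subset\mathbb R^N$ ($N\ge2$) is a bounded convex domain with smooth boundary, $d(x)=\mathrm{dist}(x,\partial\Omega)$, $\mathcal L_{1/4}u=-\Delta u-\frac1{4d^2(x)}u$. A function $u\in H^1_{loc}(\Omega)\cap C(\Omega)$ is $\mathcal L_{1/4}$-subharmonic in $\Omega$ if $\int_\Omega\nabla u\cdot\nabla\psi\,dx-\frac14\int_\Omega d^{-2}u\psi\,dx\le0$ for all $\psi\in H^1(\Omega)$, $\psi\ge0$, with compact support in $\Omega$. *)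

theory Defs
  imports "HOL-Analysis.Analysis"
begin

(* Meant for open S only: the Frechet derivative is taken at x, not within S. *)
primrec Ck_on :: "nat \<Rightarrow> 'a::euclidean_space set \<Rightarrow> ('a \<Rightarrow> real) \<Rightarrow> bool" where
  "Ck_on 0 S f \<longleftrightarrow> continuous_on S f"
| "Ck_on (Suc k) S f \<longleftrightarrow>
     f differentiable_on S \<and> (\<forall>v. Ck_on k S (\<lambda>x. frechet_derivative f (at x) v))"

definition smooth_on :: "'a::euclidean_space set \<Rightarrow> ('a \<Rightarrow> real) \<Rightarrow> bool" where
  "smooth_on S f \<longleftrightarrow> (\<forall>k. Ck_on k S f)"

(* Near each boundary point the set is the sublevel set of a smooth function without
   critical points, so it lies locally on one side of its boundary {\<rho> = 0}. *)
definition smooth_boundary :: "'a::euclidean_space set \<Rightarrow> bool" where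
  "smooth_boundary \<Omega> \<longleftrightarrow>
     (\<forall>p\<in>frontier \<Omega>. \<exists>U \<rho>. open U \<and> p \<in> U \<and> smooth_on U \<rho> \<and>
        (\<forall>x\<in>U. \<exists>v. frechet_derivative \<rho> (at x) v \<noteq> 0) \<and>
        \<Omega> \<inter> U = {x \<in> U. \<rho> x < 0})"

definition compact_support_in :: "'a::euclidean_space set \<Rightarrow> ('a \<Rightarrow> real) \<Rightarrow> bool" where
  "compact_support_in \<Omega> f \<longleftrightarrow>
     compact (closure {x \<in> \<Omega>. f x \<noteq> 0}) \<and> closure {x \<in> \<Omega>. f x \<noteq> 0} \<subseteq> \<Omega>"

definition test_function :: "'a::euclidean_space set \<Rightarrow> ('a \<Rightarrow> real) \<Rightarrow> bool" where
  "test_function \<Omega> \<phi> \<longleftrightarrow> smooth_on \<Omega> \<phi> \<and> compact_support_in \<Omega> \<phi>"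

definition locally_integrable_on ::
    "'a::euclidean_space set \<Rightarrow> ('a \<Rightarrow> 'b::euclidean_space) \<Rightarrow> bool" where
  "locally_integrable_on \<Omega> f \<longleftrightarrow>
     (\<forall>K. compact K \<and> K \<subseteq> \<Omega> \<longrightarrow> set_integrable lebesgue K f)"

definition L2_on :: "'a::euclidean_space set \<Rightarrow> ('a \<Rightarrow> 'b::euclidean_space) \<Rightarrow> bool" where
  "L2_on S f \<longleftrightarrow>
     set_borel_measurable lebesgue S f \<and> set_integrable lebesgue S (\<lambda>x. (norm (f x))\<^sup>2)"

definition L2_loc :: "'a::euclidean_space set \<Rightarrow> ('a \<Rightarrow> 'b::euclidean_space) \<Rightarrow> bool" where
  "L2_loc \<Omega> f \<longleftrightarrow> (\<forall>K. compact K \<and> K \<subseteq> \<Omega> \<longrightarrow> L2_on K f)"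

definition has_weak_gradient ::
    "'a::euclidean_space set \<Rightarrow> ('a \<Rightarrow> real) \<Rightarrow> ('a \<Rightarrow> 'a) \<Rightarrow> bool" where
  "has_weak_gradient \<Omega> u g \<longleftrightarrow>
     locally_integrable_on \<Omega> u \<and> locally_integrable_on \<Omega> g \<and>
     (\<forall>\<phi>. test_function \<Omega> \<phi> \<longrightarrow>
        (\<forall>b\<in>Basis. (LINT x:\<Omega>|lebesgue. u x * frechet_derivative \<phi> (at x) b)
                  = - (LINT x:\<Omega>|lebesgue. (g x \<bullet> b) * \<phi> x)))"

definition H1 :: "'a::euclidean_space set \<Rightarrow> ('a \<Rightarrow> real) set" where
  "H1 \<Omega> = {u. L2_on \<Omega> u \<and> (\<exists>g. has_weak_gradient \<Omega> u g \<and> L2_on \<Omega> g)}"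

definition H1_loc :: "'a::euclidean_space set \<Rightarrow> ('a \<Rightarrow> real) set" where
  "H1_loc \<Omega> = {u. L2_loc \<Omega> u \<and> (\<exists>g. has_weak_gradient \<Omega> u g \<and> L2_loc \<Omega> g)}"

definition bdist :: "'a::euclidean_space set \<Rightarrow> 'a \<Rightarrow> real" where
  "bdist \<Omega> x = infdist x (frontier \<Omega>)"

(* g and h play the roles of the gradients of u and \<psi>. Weak gradients are unique up to null
   sets and exist for u in H1_loc, \<psi> in H1, so the quantification over all of them is
   neither vacuous nor a restriction. *)
definition L_quarter_subharmonic :: "'a::euclidean_space set \<Rightarrow> ('a \<Rightarrow> real) \<Rightarrow> bool" where
  "L_quarter_subharmonic \<Omega> u \<longleftrightarrow>
     u \<in> H1_loc \<Omega> \<and> continuous_on \<Omega> u \<and>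
     (\<forall>g \<psi> h. has_weak_gradient \<Omega> u g \<and> \<psi> \<in> H1 \<Omega> \<and> has_weak_gradient \<Omega> \<psi> h \<and>
        (\<forall>x\<in>\<Omega>. 0 \<le> \<psi> x) \<and> compact_support_in \<Omega> \<psi> \<longrightarrow>
        (LINT x:\<Omega>|lebesgue. g x \<bullet> h x)
          - 1 / 4 * (LINT x:\<Omega>|lebesgue. u x * \<psi> x / (bdist \<Omega> x)\<^sup>2) \<le> 0)"

(* The filter "d(x) tends to 0, x in \<Omega>": its basic sets are {x \<in> \<Omega>. 0 < d(x) < \<epsilon>}. *)
definition to_boundary :: "'a::euclidean_space set \<Rightarrow> 'a filter" where
  "to_boundary \<Omega> = inf (filtercomap (bdist \<Omega>) (at_right 0)) (principal \<Omega>)"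

end

theory Submission
  imports Defs "HOL-Computational_Algebra.Polynomial"
begin

text \<open>Let $d$ be the distance to the boundary and $\phi(t) = \sqrt t\,(M - \log t - t)$, which satisfies
  $\phi'' + \phi/(4t^2) = -1/\sqrt t$ and is increasing on the range of $d$ for large $M$. If $u$ is
  positive somewhere, the boundary condition forces $u/\phi(d)$ to attain a positive maximum $\kappa$.
  Mollify $u$ at a small scale to $U$, normalised so that $U$ is close to $u$. Then
  $U - \kappa\,\phi(d)$ has an interior local maximum $y$. Since the domain is convex, $d$ is touched
  from above at $y$ by an affine function $\ell$ with unit gradient, so $U - \kappa\,\phi(\ell)$ also has
  a local maximum at $y$ and $\Delta U(y) \le \kappa\,\phi''(d(y))$. Testing the weak inequality with the
  mollifier centred at $y$ gives $-\Delta U(y) \le \kappa\,\phi(d(y))/(4d(y)^2)$ up to a small error,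
  which contradicts the strict inequality for $\phi$.\<close>

subsection \<open>Smooth bump functions\<close>

text \<open>The constant 1/4 is critical: \<open>sqrt t\<close> and \<open>sqrt t * ln t\<close>
  both solve the one-dimensional equation, and the growth forbidden to u is that of the larger one.
  So near the boundary u lies below any prescribed positive multiple of \<phi>(d).

  A solution of the equation itself would only give equality at the maximum. The summand
  \<open>- t * sqrt t\<close> contributes -(3/4 + 1/4)/sqrt t, a gap that stays away from 0 because
  d is bounded, and this gap absorbs every error of the mollification.

  Two obstacles shape the argument: u has no second derivatives, and d is treated as merely
  Lipschitz. Against the first, all derivatives are moved to the kernel. Against the second, only
  second difference quotients at the maximum are compared, for which the one-sided bound by \<ell>
  and the monotonicity of \<phi> suffice.

  Testing averages u/d^2 over a small ball instead of dividing the average of u by d(y)^2, so u and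
  u/d^2 are approximated side by side. Mollifying may also move the maximum; the factor 1/2 kept in
  reserve near the boundary stops it from reaching the edge of the compact set on which it is
  sought.\<close>

lemma poly_div_exp_tendsto_0:
  fixes p :: "real poly"
  shows "((\<lambda>x. poly p x / exp x) \<longlongrightarrow> 0) at_top"
proof -
  have "((\<lambda>x. \<Sum>i\<le>degree p. coeff p i * (x ^ i / exp x)) \<longlongrightarrow> (\<Sum>i\<le>degree p. coeff p i * 0)) at_top"
    by (intro tendsto_sum tendsto_mult tendsto_const tendsto_power_div_exp_0)
  then show ?thesis
    by (simp add: poly_altdef sum_divide_distrib)
qed

text \<open>For p = 1 this is the classical flat function exp(-1/t). The polynomial factor is
  carried along because differentiation then stays inside the family.\<close>

definition flat_exp :: "real poly \<Rightarrow> real \<Rightarrow> real" where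
  "flat_exp p t = (if 0 < t then poly p (1 / t) * exp (- (1 / t)) else 0)"

text \<open>With x = 1/t, the derivative of p(x) exp(-x) in t is x^2 (p(x) - p'(x)) exp(-x), since
  dx/dt = -x^2.\<close>

definition flat_deriv :: "real poly \<Rightarrow> real poly" where
  "flat_deriv p = [:0, 0, 1:] * (p - pderiv p)"

lemma flat_exp_tendsto_0: "(flat_exp p \<longlongrightarrow> 0) (at 0)"
proof -
  have right: "(flat_exp p \<longlongrightarrow> 0) (at_right 0)"
  proof (rule Lim_transform_eventually)
    have "filterlim (\<lambda>t::real. 1 / t) at_top (at_right 0)"
      using filterlim_inverse_at_top_right by (simp add: inverse_eq_divide)
    from filterlim_compose[OF poly_div_exp_tendsto_0 this]
    show "((\<lambda>t. poly p (1 / t) / exp (1 / t)) \<longlongrightarrow> 0) (at_right 0)" .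
    show "\<forall>\<^sub>F t in at_right 0. poly p (1 / t) / exp (1 / t) = flat_exp p t"
      using eventually_at_right_less[of "0::real"]
      by eventually_elim (simp add: flat_exp_def exp_minus divide_inverse)
  qed
  have left: "(flat_exp p \<longlongrightarrow> 0) (at_left 0)"
  proof (rule Lim_transform_eventually[OF tendsto_const])
    show "\<forall>\<^sub>F t in at_left 0. 0 = flat_exp p t"
      by (auto simp: eventually_at_left_field flat_exp_def intro: exI[of _ "-1"])
  qed
  show ?thesis
    using left right by (simp add: filterlim_split_at)
qed

lemma DERIV_flat_exp: "DERIV (flat_exp p) t :> flat_exp (flat_deriv p) t"
proof -
  consider "t < 0" | "t = 0" | "0 < t" by linarith
  then show ?thesis
  proof cases
    case 1
    have "DERIV (\<lambda>_. 0) t :> (0::real)" by simp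
    moreover have "\<forall>\<^sub>F s in nhds t. 0 = flat_exp p s"
      using 1 by (intro eventually_nhds_in_open[of "{..<0}", THEN eventually_mono])
        (auto simp: flat_exp_def)
    ultimately show ?thesis
      using 1 DERIV_cong_ev[of t t "\<lambda>_. 0" "flat_exp p" 0 0] by (simp add: flat_exp_def)
  next
    case 2
    \<comment> \<open>Dividing by h multiplies the polynomial in 1/h by its variable, so the
      difference quotient at 0 is again a member of the family and tends to 0.\<close>
    have "((\<lambda>h. (flat_exp p (0 + h) - flat_exp p 0) / h) \<longlongrightarrow> 0) (at 0)"
    proof (rule Lim_transform_eventually[OF flat_exp_tendsto_0[of "[:0, 1:] * p"]])
      show "\<forall>\<^sub>F h in at 0. flat_exp ([:0, 1:] * p) h = (flat_exp p (0 + h) - flat_exp p 0) / h"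
        by (simp add: flat_exp_def eventually_at_filter)
    qed
    then show ?thesis
      using 2 by (simp add: DERIV_def flat_exp_def)
  next
    case 3
    have deriv: "DERIV (\<lambda>s. poly p (1 / s) * exp (- (1 / s))) t :> flat_exp (flat_deriv p) t"
      using 3 by (auto intro!: derivative_eq_intros DERIV_chain'[OF _ poly_DERIV]
          simp: flat_exp_def flat_deriv_def field_simps power2_eq_square)
    have ev: "\<forall>\<^sub>F s in nhds t. poly p (1 / s) * exp (- (1 / s)) = flat_exp p s"
      using 3 by (intro eventually_nhds_in_open[of "{0<..}", THEN eventually_mono])
        (auto simp: flat_exp_def)
    show ?thesis
      using DERIV_cong_ev[OF refl ev refl] deriv by simp
  qed
qed

text \<open>\<open>Ck_on\<close> asks for iterated directional derivatives, so stability of a class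
  under one such derivative settles every order at once, with no formula for higher derivatives of
  the bump.\<close>

lemma Ck_on_derivative_closed:
  assumes diff: "\<And>f x. f \<in> F \<Longrightarrow> f differentiable at x"
    and closed: "\<And>f v. f \<in> F \<Longrightarrow> (\<lambda>x. frechet_derivative f (at x) v) \<in> F"
    and "f \<in> F"
  shows "Ck_on k S f"
  using \<open>f \<in> F\<close>
proof (induction k arbitrary: f)
  case 0
  then show ?case
    by (auto intro!: continuous_at_imp_continuous_on differentiable_imp_continuous_within diff)
next
  case (Suc k)
  then show ?case
    by (auto simp: differentiable_on_def intro: diff closed differentiable_at_withinI)
qed

text \<open>An algebra containing the bump functions and closed under directional derivatives.\<close>

inductive_set bump_algebra :: "real \<Rightarrow> 'a::euclidean_space \<Rightarrow> ('a \<Rightarrow> real) set" for \<delta> y where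
  flat: "(\<lambda>x. flat_exp p (\<delta>\<^sup>2 - (norm (x - y))\<^sup>2)) \<in> bump_algebra \<delta> y"
| linear: "(\<lambda>x. c * ((x - y) \<bullet> v)) \<in> bump_algebra \<delta> y"
| const: "(\<lambda>x. c) \<in> bump_algebra \<delta> y"
| add: "f \<in> bump_algebra \<delta> y \<Longrightarrow> g \<in> bump_algebra \<delta> y \<Longrightarrow> (\<lambda>x. f x + g x) \<in> bump_algebra \<delta> y"
| mult: "f \<in> bump_algebra \<delta> y \<Longrightarrow> g \<in> bump_algebra \<delta> y \<Longrightarrow> (\<lambda>x. f x * g x) \<in> bump_algebra \<delta> y"

text \<open>The chain rule brings out a factor linear in x - y; this is why the algebra has the
  generators \<open>flat\<close> and \<open>linear\<close>.\<close>

lemma flat_exp_norm_has_derivative: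
  fixes y :: "'a::euclidean_space"
  shows "((\<lambda>x. flat_exp p (\<delta>\<^sup>2 - (norm (x - y))\<^sup>2)) has_derivative
     (\<lambda>v. flat_exp (flat_deriv p) (\<delta>\<^sup>2 - (norm (x - y))\<^sup>2) * ((-2) * ((x - y) \<bullet> v)))) (at x)"
proof -
  have "((\<lambda>x. \<delta>\<^sup>2 - (norm (x - y))\<^sup>2) has_derivative (\<lambda>v. (-2) * ((x - y) \<bullet> v))) (at x)"
    unfolding power2_norm_eq_inner
    by (auto intro!: derivative_eq_intros simp: inner_commute)
  from has_derivative_compose[OF this DERIV_flat_exp[unfolded has_field_derivative_def]]
  show ?thesis by simp
qed

lemma bump_algebra_derivative:
  assumes "f \<in> bump_algebra \<delta> y"
  shows "\<exists>f'. (\<forall>x. (f has_derivative f' x) (at x)) \<and> (\<forall>v. (\<lambda>x. f' x v) \<in> bump_algebra \<delta> y)"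
  using assms
proof induction
  case (flat p)
  show ?case
    by (intro exI conjI allI, rule flat_exp_norm_has_derivative) (intro bump_algebra.intros)
next
  case (linear c v)
  have "((\<lambda>x. c * ((x - y) \<bullet> v)) has_derivative (\<lambda>w. c * (w \<bullet> v))) (at x)" for x
    by (auto intro!: derivative_eq_intros)
  then show ?case
    by (intro exI[of _ "\<lambda>x w. c * (w \<bullet> v)"]) (auto intro: bump_algebra.intros)
next
  case (const c)
  show ?case by (intro exI[of _ "\<lambda>_ _. 0"]) (auto intro: bump_algebra.intros)
next
  case (add f g)
  then obtain f' g' where "\<forall>x. (f has_derivative f' x) (at x)" "\<forall>v. (\<lambda>x. f' x v) \<in> bump_algebra \<delta> y"
    "\<forall>x. (g has_derivative g' x) (at x)" "\<forall>v. (\<lambda>x. g' x v) \<in> bump_algebra \<delta> y" by blast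
  then show ?case
    by (intro exI[of _ "\<lambda>x v. f' x v + g' x v"]) (auto intro: bump_algebra.intros has_derivative_add)
next
  case (mult f g)
  then obtain f' g' where "\<forall>x. (f has_derivative f' x) (at x)" "\<forall>v. (\<lambda>x. f' x v) \<in> bump_algebra \<delta> y"
    "\<forall>x. (g has_derivative g' x) (at x)" "\<forall>v. (\<lambda>x. g' x v) \<in> bump_algebra \<delta> y" by blast
  with mult.hyps show ?case
    by (intro exI[of _ "\<lambda>x v. f x * g' x v + f' x v * g x"])
      (auto intro!: bump_algebra.intros(4,5) has_derivative_mult)
qed

lemma bump_algebra_differentiable:
  "f \<in> bump_algebra \<delta> y \<Longrightarrow> f differentiable at x"
  using bump_algebra_derivative unfolding differentiable_def by blast

lemma bump_algebra_frechet_derivative: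
  assumes "f \<in> bump_algebra \<delta> y"
  shows "(\<lambda>x. frechet_derivative f (at x) v) \<in> bump_algebra \<delta> y"
proof -
  obtain f' where f': "\<forall>x. (f has_derivative f' x) (at x)" "\<forall>v. (\<lambda>x. f' x v) \<in> bump_algebra \<delta> y"
    using bump_algebra_derivative[OF assms] by blast
  have "frechet_derivative f (at x) = f' x" for x
    using f'(1) frechet_derivative_at by metis
  with f'(2) show ?thesis by simp
qed

lemma bump_algebra_smooth_on: "f \<in> bump_algebra \<delta> y \<Longrightarrow> smooth_on S f"
  unfolding smooth_on_def
  by (blast intro: Ck_on_derivative_closed[of "bump_algebra \<delta> y"] bump_algebra_differentiable
      bump_algebra_frechet_derivative)

lemma bump_algebra_continuous_on: "f \<in> bump_algebra \<delta> y \<Longrightarrow> continuous_on S f"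
  using bump_algebra_smooth_on[of f \<delta> y S] unfolding smooth_on_def
  by (metis Ck_on.simps(1))

text \<open>The standard mollifying kernel exp(-1/(\<delta>^2 - |x - y|^2)) on the ball of radius
  \<delta>, left without normalisation.\<close>

definition bump :: "real \<Rightarrow> 'a::euclidean_space \<Rightarrow> 'a \<Rightarrow> real" where
  "bump \<delta> y x = flat_exp 1 (\<delta>\<^sup>2 - (norm (x - y))\<^sup>2)"

lemma bump_in_algebra: "bump \<delta> y \<in> bump_algebra \<delta> y"
  unfolding bump_def by (rule bump_algebra.flat)

lemma bump_nonneg: "0 \<le> bump \<delta> y x"
  by (simp add: bump_def flat_exp_def)

lemma bump_le_1: "bump \<delta> y x \<le> 1"
  by (simp add: bump_def flat_exp_def)

lemma bump_pos: "0 < \<delta> \<Longrightarrow> 0 < bump \<delta> y y"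
  by (simp add: bump_def flat_exp_def)

lemma bump_eq_0: "0 \<le> \<delta> \<Longrightarrow> x \<notin> cball y \<delta> \<Longrightarrow> bump \<delta> y x = 0"
  by (auto simp: bump_def flat_exp_def dist_norm norm_minus_commute not_le
      dest: power_strict_mono[of \<delta> _ 2])

text \<open>Moving the centre one way is moving the argument the other way, so differences of a
  mollification in its centre become differences of the kernel in the integration variable.\<close>

lemma bump_translate: "bump \<delta> (y + h) x = bump \<delta> y (x - h)"
  by (simp add: bump_def algebra_simps)

lemma frechet_derivative_outside:
  fixes f :: "'a::euclidean_space \<Rightarrow> real"
  assumes "closed K" "\<And>x. x \<notin> K \<Longrightarrow> f x = 0" "x \<notin> K"
  shows "frechet_derivative f (at x) v = 0"
proof -
  have "((\<lambda>_. 0) has_derivative (\<lambda>_. 0)) (at x)" by simp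
  then have "(f has_derivative (\<lambda>_. 0)) (at x)"
    using assms by (rule_tac has_derivative_transform_within_open[of _ _ _ _ "- K"]) auto
  then show ?thesis
    using frechet_derivative_at by metis
qed

subsection \<open>Weak gradients of bump functions\<close>

lemma set_integrable_continuous_compact:
  fixes f :: "'a::euclidean_space \<Rightarrow> 'b::euclidean_space"
  assumes "compact K" "continuous_on K f"
  shows "set_integrable lebesgue K f"
proof -
  have "integrable lborel (\<lambda>x. indicator K x *\<^sub>R f x)"
    using borel_integrable_compact[OF assms] by (simp add: set_integrable_def)
  then show ?thesis
    unfolding set_integrable_def
    using integrable_completion[OF borel_measurable_integrable] by blast
qed

lemma indicator_scaleR_restrict:
  fixes f :: "'a \<Rightarrow> 'b::real_vector"
  assumes "K \<subseteq> \<Omega>" "\<And>x. x \<in> \<Omega> \<Longrightarrow> x \<notin> K \<Longrightarrow> f x = 0"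
  shows "(\<lambda>x. indicator \<Omega> x *\<^sub>R f x) = (\<lambda>x. indicator K x *\<^sub>R f x)"
  using assms by (auto simp: indicator_def fun_eq_iff)

lemma set_integrable_compact_support:
  fixes f :: "'a::euclidean_space \<Rightarrow> 'b::euclidean_space"
  assumes "compact K" "K \<subseteq> \<Omega>" "continuous_on K f" "\<And>x. x \<in> \<Omega> \<Longrightarrow> x \<notin> K \<Longrightarrow> f x = 0"
  shows "set_integrable lebesgue \<Omega> f"
  using set_integrable_continuous_compact[OF assms(1,3)]
  unfolding set_integrable_def
  by (rule back_subst[where P = "integrable lebesgue"])
    (rule indicator_scaleR_restrict[OF assms(2,4), symmetric])

section \<open>Directional derivatives of compactly supported functions integrate to zero\<close>

lemma has_real_derivative_along_line:
  fixes f :: "'a::euclidean_space \<Rightarrow> real"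
  assumes "(f has_derivative f') (at (x + t *\<^sub>R b))"
  shows "((\<lambda>s. f (x + s *\<^sub>R b)) has_real_derivative f' b) (at t)"
proof -
  have "((\<lambda>s. x + s *\<^sub>R b) has_derivative (\<lambda>s. s *\<^sub>R b)) (at t)"
    by (auto intro!: derivative_eq_intros)
  from has_derivative_compose[OF this assms]
  have "((\<lambda>s. f (x + s *\<^sub>R b)) has_derivative (\<lambda>s. f' (s *\<^sub>R b))) (at t)" .
  moreover have "(\<lambda>s. f' (s *\<^sub>R b)) = (*) (f' b)"
    using linear_scale[OF has_derivative_linear[OF assms]] by (auto simp: mult.commute)
  ultimately show ?thesis
    by (simp add: has_field_derivative_def)
qed

lemma bounded_compact_support:
  fixes f :: "'a::euclidean_space \<Rightarrow> real"
  assumes "compact K" "continuous_on K f" "\<And>x. x \<notin> K \<Longrightarrow> f x = 0"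
  shows "\<exists>C>0. \<forall>x. \<bar>f x\<bar> \<le> C"
proof -
  have "bounded (f ` K)"
    using assms compact_continuous_image compact_imp_bounded by blast
  then obtain C where "0 < C" "\<forall>x\<in>K. \<bar>f x\<bar> \<le> C"
    by (auto simp: bounded_pos)
  then show ?thesis
    using assms(3) by (metis abs_zero less_imp_le)
qed

lemma lborel_integral_translate:
  fixes p :: "'a::euclidean_space \<Rightarrow> real"
  assumes "p \<in> borel_measurable borel"
  shows "(LINT x|lborel. p (x + c)) = (LINT x|lborel. p x)"
proof -
  have "(LINT x|lborel. p x) = (LINT x|distr lborel borel ((+) c). p x)"
    by (simp add: lborel_distr_plus)
  also have "\<dots> = (LINT x|lborel. p (c + x))"
    using assms by (intro integral_distr) auto
  finally show ?thesis
    by (simp add: add.commute)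
qed

text \<open>The difference quotients have integral zero by translation invariance of the measure.\<close>

lemma integral_directional_derivative_eq_0:
  fixes p :: "'a::euclidean_space \<Rightarrow> real"
  assumes der: "\<And>x. (p has_derivative p' x) (at x)"
    and cont: "continuous_on UNIV (\<lambda>x. p' x b)"
    and K: "compact K" "\<And>x. x \<notin> K \<Longrightarrow> p x = 0"
  shows "(LINT x|lebesgue. p' x b) = 0"
proof -
  have p'0: "p' x b = 0" if "x \<notin> K" for x
    using frechet_derivative_outside[of K p x b, OF compact_imp_closed[OF K(1)] K(2) that]
    unfolding frechet_derivative_at[OF der, symmetric] .
  obtain C where C: "0 < C" "\<And>x. \<bar>p' x b\<bar> \<le> C"
    using bounded_compact_support[of K "\<lambda>x. p' x b",
        OF K(1) continuous_on_subset[OF cont subset_UNIV] p'0] by blast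
  obtain r where r: "K \<subseteq> cball 0 r"
    using bounded_subset_ballD[OF compact_imp_bounded[OF K(1)], of 0] ball_subset_cball by blast
  \<comment> \<open>The increments are at most \<open>norm b\<close> in length, so this enlarged
    ball contains the supports of all difference quotients and gives one dominating
    function.\<close>
  define B where "B = cball (0::'a) (r + norm b)"
  define s where "s n x = (p (x + (1 / Suc n) *\<^sub>R b) - p x) * Suc n" for n :: nat and x
  have cont_p: "continuous_on UNIV p"
    using der by (intro continuous_at_imp_continuous_on) (auto intro: has_derivative_continuous)
  have meas [measurable]: "p \<in> borel_measurable borel" "(\<lambda>x. p' x b) \<in> borel_measurable borel"
    using cont_p cont by (auto intro: borel_measurable_continuous_onI)
  have int: "integrable lborel p"
  proof -
    have "(\<lambda>x. indicator K x *\<^sub>R p x) = p"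
      using K(2) by (auto simp: indicator_def fun_eq_iff)
    with borel_integrable_compact[OF K(1) continuous_on_subset[OF cont_p subset_UNIV]]
    show ?thesis by simp
  qed
  have int_shift: "integrable lborel (\<lambda>x. p (x + c))" for c
  proof -
    have "integrable (distr lborel borel ((+) c)) p"
      using int by (simp add: lborel_distr_plus)
    then show ?thesis
      by (subst (asm) integrable_distr_eq) (auto simp: add.commute)
  qed
  have "(\<lambda>n. LINT x|lborel. s n x) \<longlonglongrightarrow> (LINT x|lborel. p' x b)"
  proof (rule integral_dominated_convergence)
    show "integrable lborel (\<lambda>x. C * indicator B x)"
      using emeasure_lborel_cball_finite[of "0::'a" "r + norm b"] unfolding B_def
      by (intro integrable_mult_right integrable_real_indicator) auto
    show "AE x in lborel. (\<lambda>n. s n x) \<longlonglongrightarrow> p' x b"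
    proof (rule AE_I2)
      fix x
      have "((\<lambda>h. (p (x + h *\<^sub>R b) - p x) / h) \<longlongrightarrow> p' x b) (at 0)"
        using has_real_derivative_along_line[of p "p' x" x 0 b] der[of x] by (simp add: DERIV_def)
      moreover have "filterlim (\<lambda>n. 1 / real (Suc n)) (at 0) sequentially"
        using LIMSEQ_Suc[OF lim_1_over_n] by (auto simp: filterlim_at)
      ultimately have "(\<lambda>n. (p (x + (1 / Suc n) *\<^sub>R b) - p x) / (1 / Suc n)) \<longlonglongrightarrow> p' x b"
        by (rule filterlim_compose)
      then show "(\<lambda>n. s n x) \<longlonglongrightarrow> p' x b"
        unfolding s_def by simp
    qed
    show "AE x in lborel. norm (s n x) \<le> C * indicator B x" for n
    proof (rule AE_I2)
      fix x
      define t where "t = 1 / real (Suc n)"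
      have t: "0 < t" "t \<le> 1" by (auto simp: t_def)
      show "norm (s n x) \<le> C * indicator B x"
      proof (cases "x \<in> B")
        case True
        obtain z where "p (x + t *\<^sub>R b) - p (x + 0 *\<^sub>R b) = (t - 0) * p' (x + z *\<^sub>R b) b"
          using MVT2[of 0 t "\<lambda>s. p (x + s *\<^sub>R b)" "\<lambda>s. p' (x + s *\<^sub>R b) b"] t(1)
            has_real_derivative_along_line[OF der] by blast
        then have "s n x = p' (x + z *\<^sub>R b) b"
          using t by (simp add: s_def t_def)
        then show ?thesis using C(2) True by simp
      next
        case False
        then have x: "norm x > r + norm b" by (simp add: B_def)
        have "norm (t *\<^sub>R b) \<le> norm b"
          using t by (simp add: mult_left_le_one_le)
        then have "norm (x + t *\<^sub>R b) > r"
          using x norm_triangle_ineq4[of "x + t *\<^sub>R b" "t *\<^sub>R b"] by simp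
        moreover have "norm x > r" using x norm_ge_zero[of b] by linarith
        ultimately have "x \<notin> K" "x + t *\<^sub>R b \<notin> K" using r by auto
        then show ?thesis using K(2) False by (simp add: s_def t_def)
      qed
    qed
  qed (unfold s_def, measurable)
  moreover have "(LINT x|lborel. s n x) = 0" for n
    unfolding s_def using int int_shift lborel_integral_translate[OF meas(1)]
    by simp
  ultimately have "(LINT x|lborel. p' x b) = 0"
    by (simp add: LIMSEQ_const_iff)
  then show ?thesis
    using integral_completion[of "\<lambda>x. p' x b" lborel] by simp
qed

section \<open>Derivatives of the bump and integration by parts\<close>

definition bump_partial :: "real \<Rightarrow> 'a::euclidean_space \<Rightarrow> 'a \<Rightarrow> 'a \<Rightarrow> real" where
  "bump_partial \<delta> y b x = frechet_derivative (bump \<delta> y) (at x) b"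

text \<open>Only the pure second derivative: summed over \<open>Basis\<close>, it gives the
  Laplacian of the bump.\<close>

definition bump_partial2 :: "real \<Rightarrow> 'a::euclidean_space \<Rightarrow> 'a \<Rightarrow> 'a \<Rightarrow> real" where
  "bump_partial2 \<delta> y b x = frechet_derivative (bump_partial \<delta> y b) (at x) b"

lemma bump_partial_in_algebra: "bump_partial \<delta> y b \<in> bump_algebra \<delta> y"
  using bump_algebra_frechet_derivative[OF bump_in_algebra, of \<delta> y b]
  by (simp add: bump_partial_def[abs_def])

lemma bump_partial2_in_algebra: "bump_partial2 \<delta> y b \<in> bump_algebra \<delta> y"
  using bump_algebra_frechet_derivative[OF bump_partial_in_algebra, of \<delta> y b b]
  by (simp add: bump_partial2_def[abs_def])

lemmas continuous_on_bump [continuous_intros] =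
  bump_algebra_continuous_on[OF bump_in_algebra]
  bump_algebra_continuous_on[OF bump_partial_in_algebra]
  bump_algebra_continuous_on[OF bump_partial2_in_algebra]

lemma bump_partial_eq_0: "0 \<le> \<delta> \<Longrightarrow> x \<notin> cball y \<delta> \<Longrightarrow> bump_partial \<delta> y b x = 0"
  unfolding bump_partial_def
  by (rule frechet_derivative_outside[OF closed_cball bump_eq_0])

lemma bump_partial2_eq_0: "0 \<le> \<delta> \<Longrightarrow> x \<notin> cball y \<delta> \<Longrightarrow> bump_partial2 \<delta> y b x = 0"
  unfolding bump_partial2_def
  by (rule frechet_derivative_outside[OF closed_cball bump_partial_eq_0])

lemma compact_support_in_subset:
  assumes "compact K" "K \<subseteq> \<Omega>" "\<And>x. x \<in> \<Omega> \<Longrightarrow> x \<notin> K \<Longrightarrow> f x = 0"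
  shows "compact_support_in \<Omega> f"
proof -
  have "closure {x \<in> \<Omega>. f x \<noteq> 0} \<subseteq> K"
    using assms by (intro closure_minimal compact_imp_closed) auto
  then show ?thesis
    using assms by (auto simp: compact_support_in_def intro: compact_closure[THEN iffD2]
        bounded_subset[OF compact_imp_bounded] closure_subset[THEN subset_trans])
qed

text \<open>The product of the bump with a test function is differentiable on the whole space with
  continuous partial derivatives and compact support. Its directional derivative has integral zero,
  and the product rule turns this into integration by parts.\<close>

lemma bump_has_weak_gradient:
  fixes y :: "'a::euclidean_space"
  assumes \<Omega>: "open \<Omega>" and \<delta>: "0 < \<delta>" "cball y \<delta> \<subseteq> \<Omega>"
  shows "has_weak_gradient \<Omega> (bump \<delta> y) (\<lambda>x. \<Sum>b\<in>Basis. bump_partial \<delta> y b x *\<^sub>R b)"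
  unfolding has_weak_gradient_def locally_integrable_on_def
proof (intro conjI allI impI ballI)
  fix \<phi> :: "'a \<Rightarrow> real" and b :: 'a
  assume \<phi>: "test_function \<Omega> \<phi>" and b: "b \<in> Basis"
  define K where "K = cball y \<delta>"
  have K: "compact K" "K \<subseteq> \<Omega>" "open (- K)" using \<delta> by (auto simp: K_def)
  have "Ck_on (Suc 0) \<Omega> \<phi>"
    using \<phi> unfolding test_function_def smooth_on_def by blast
  then have "\<phi> differentiable_on \<Omega>"
    and D\<phi>_cont: "continuous_on \<Omega> (\<lambda>x. frechet_derivative \<phi> (at x) b)"
    by auto
  then have \<phi>_diff: "(\<phi> has_derivative frechet_derivative \<phi> (at x)) (at x)" if "x \<in> \<Omega>" for x
    using that \<Omega> by (metis at_within_open differentiable_on_def frechet_derivative_works)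
  have \<phi>_cont: "continuous_on \<Omega> \<phi>"
    using \<phi>_diff by (intro continuous_at_imp_continuous_on) (auto intro: has_derivative_continuous)
  have out: "bump \<delta> y x = 0" "bump_partial \<delta> y v x = 0" if "x \<notin> K" for x v
    using that \<delta> bump_eq_0[of \<delta> x y] bump_partial_eq_0[of \<delta> x y] by (auto simp: K_def)
  define p where "p x = bump \<delta> y x * \<phi> x" for x
  \<comment> \<open>A test function is controlled only inside \<Omega> and may take any values
    elsewhere. The derivative is therefore set to 0 outside \<Omega>, and its continuity is glued
    from the open sets \<Omega> and \<open>- K\<close>, which cover the space.\<close>
  define p' where "p' x v = (if x \<in> \<Omega> then bump \<delta> y x * frechet_derivative \<phi> (at x) v
     + bump_partial \<delta> y v x * \<phi> x else 0)" for x v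
  have der: "(p has_derivative p' x) (at x)" for x
  proof (cases "x \<in> \<Omega>")
    case True
    have "(bump \<delta> y has_derivative (\<lambda>v. bump_partial \<delta> y v x)) (at x)"
      using bump_algebra_differentiable[OF bump_in_algebra, of \<delta> y x]
      unfolding frechet_derivative_works by (simp add: bump_partial_def)
    from has_derivative_mult[OF this \<phi>_diff[OF True]] True show ?thesis
      unfolding p_def[abs_def] p'_def by simp
  next
    case False
    have "((\<lambda>_. 0) has_derivative (\<lambda>_. 0)) (at x)" by simp
    then have "(p has_derivative (\<lambda>_. 0)) (at x)"
      using K False out
      by (rule_tac has_derivative_transform_within_open[of _ _ _ _ "- K"]) (auto simp: p_def)
    moreover have "p' x = (\<lambda>_. 0)" using False by (simp add: p'_def fun_eq_iff)
    ultimately show ?thesis by simp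
  qed
  have cont: "continuous_on UNIV (\<lambda>x. p' x b)"
  proof -
    have "continuous_on \<Omega> (\<lambda>x. p' x b) \<longleftrightarrow> continuous_on \<Omega>
        (\<lambda>x. bump \<delta> y x * frechet_derivative \<phi> (at x) b + bump_partial \<delta> y b x * \<phi> x)"
      by (rule continuous_on_cong) (auto simp: p'_def)
    also have \<dots>
      by (intro continuous_intros D\<phi>_cont \<phi>_cont)
    finally have "continuous_on \<Omega> (\<lambda>x. p' x b)" .
    moreover have "continuous_on (- K) (\<lambda>x. p' x b) \<longleftrightarrow> continuous_on (- K) (\<lambda>x. 0 :: real)"
      by (rule continuous_on_cong) (auto simp: p'_def out)
    ultimately have "continuous_on (\<Omega> \<union> - K) (\<lambda>x. p' x b)"
      using \<Omega> K(3) by (intro continuous_on_open_Un) auto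
    moreover have "\<Omega> \<union> - K = UNIV" using K by auto
    ultimately show ?thesis by simp
  qed
  have int1: "set_integrable lebesgue \<Omega> (\<lambda>x. bump \<delta> y x * frechet_derivative \<phi> (at x) b)"
    and int2: "set_integrable lebesgue \<Omega> (\<lambda>x. bump_partial \<delta> y b x * \<phi> x)"
    using out K
    by (auto intro!: set_integrable_compact_support[OF K(1,2)] continuous_intros
        continuous_on_subset[OF D\<phi>_cont] continuous_on_subset[OF \<phi>_cont])
  have "(LINT x|lebesgue. p' x b) = (LINT x:\<Omega>|lebesgue. bump \<delta> y x * frechet_derivative \<phi> (at x) b
     + bump_partial \<delta> y b x * \<phi> x)"
    unfolding set_lebesgue_integral_def p'_def
    by (rule Bochner_Integration.integral_cong) auto
  also have "(LINT x|lebesgue. p' x b) = 0"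
    using out by (intro integral_directional_derivative_eq_0[OF der cont K(1)]) (simp add: p_def)
  finally have "(LINT x:\<Omega>|lebesgue. bump \<delta> y x * frechet_derivative \<phi> (at x) b)
      + (LINT x:\<Omega>|lebesgue. bump_partial \<delta> y b x * \<phi> x) = 0"
    using int1 int2 by simp
  moreover have "(\<Sum>c\<in>Basis. bump_partial \<delta> y c x *\<^sub>R c) \<bullet> b = bump_partial \<delta> y b x" for x
    using b by simp
  ultimately show "(LINT x:\<Omega>|lebesgue. bump \<delta> y x * frechet_derivative \<phi> (at x) b) =
      - (LINT x:\<Omega>|lebesgue. ((\<Sum>c\<in>Basis. bump_partial \<delta> y c x *\<^sub>R c) \<bullet> b) * \<phi> x)"
    by simp
qed (auto intro!: set_integrable_continuous_compact continuous_intros)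

lemma L2_on_compact_support:
  fixes f :: "'a::euclidean_space \<Rightarrow> 'b::euclidean_space"
  assumes "compact K" "K \<subseteq> \<Omega>" "continuous_on K f" "\<And>x. x \<in> \<Omega> \<Longrightarrow> x \<notin> K \<Longrightarrow> f x = 0"
  shows "L2_on \<Omega> f"
proof -
  have "set_integrable lebesgue \<Omega> f"
    using set_integrable_compact_support[OF assms] .
  then have "set_borel_measurable lebesgue \<Omega> f"
    unfolding set_integrable_def set_borel_measurable_def by (rule borel_measurable_integrable)
  moreover have "set_integrable lebesgue \<Omega> (\<lambda>x. (norm (f x))\<^sup>2)"
    using assms by (intro set_integrable_compact_support[OF assms(1,2)] continuous_intros) auto
  ultimately show ?thesis by (simp add: L2_on_def)
qed

text \<open>The bump is an admissible \<psi>, which leaves the integral of g against its gradient.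
  The partial derivatives of the bump are themselves test functions, so the definition of the weak
  gradient of u moves the remaining derivative to the kernel as well. No derivative of u
  survives.\<close>

lemma subharmonic_bump_inequality:
  fixes y :: "'a::euclidean_space"
  assumes \<Omega>: "open \<Omega>" and u: "L_quarter_subharmonic \<Omega> u" and \<delta>: "0 < \<delta>" "cball y \<delta> \<subseteq> \<Omega>"
  shows "- (\<Sum>b\<in>Basis. LINT x:\<Omega>|lebesgue. u x * bump_partial2 \<delta> y b x)
    \<le> 1 / 4 * (LINT x:\<Omega>|lebesgue. u x * bump \<delta> y x / (bdist \<Omega> x)\<^sup>2)"
proof -
  define K where "K = cball y \<delta>"
  define h where "h x = (\<Sum>b\<in>Basis. bump_partial \<delta> y b x *\<^sub>R b)" for x
  have K: "compact K" "K \<subseteq> \<Omega>" using \<delta> by (auto simp: K_def)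
  have out: "bump \<delta> y x = 0" "bump_partial \<delta> y v x = 0" "h x = 0" if "x \<notin> K" for x v
    using that \<delta> bump_eq_0[of \<delta> x y] bump_partial_eq_0[of \<delta> x y] by (auto simp: K_def h_def)
  obtain g where g: "has_weak_gradient \<Omega> u g"
    using u by (auto simp: L_quarter_subharmonic_def H1_loc_def)
  have wg: "has_weak_gradient \<Omega> (bump \<delta> y) h"
    using bump_has_weak_gradient[OF \<Omega> \<delta>] by (simp add: h_def[abs_def])
  have "L2_on \<Omega> (bump \<delta> y)" "L2_on \<Omega> h"
    using out by (auto intro!: L2_on_compact_support[OF K] continuous_intros simp: h_def[abs_def])
  with wg have "bump \<delta> y \<in> H1 \<Omega>" by (auto simp: H1_def)
  moreover have supp: "compact_support_in \<Omega> (bump \<delta> y)" "compact_support_in \<Omega> (bump_partial \<delta> y b)" for b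
    using out by (auto intro: compact_support_in_subset[OF K])
  ultimately have ineq: "(LINT x:\<Omega>|lebesgue. g x \<bullet> h x)
      \<le> 1 / 4 * (LINT x:\<Omega>|lebesgue. u x * bump \<delta> y x / (bdist \<Omega> x)\<^sup>2)"
    using u g wg bump_nonneg[of \<delta> y] unfolding L_quarter_subharmonic_def by fastforce
  \<comment> \<open>Splitting the integral of the sum over \<open>Basis\<close> requires each
    summand to be integrable: g is integrable on K, and the other factor is bounded and vanishes off
    K.\<close>
  have int: "set_integrable lebesgue \<Omega> (\<lambda>x. (g x \<bullet> b) * bump_partial \<delta> y b x)" for b
  proof -
    obtain C where C: "\<And>x. \<bar>bump_partial \<delta> y b x\<bar> \<le> C"
      using bounded_compact_support[OF K(1) continuous_on_bump(2) out(2)] by metis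
    have gK: "set_integrable lebesgue K g"
      using g K by (auto simp: has_weak_gradient_def locally_integrable_on_def)
    have "integrable lebesgue (\<lambda>x. bump_partial \<delta> y b x * ((indicator K x *\<^sub>R g x) \<bullet> b))"
    proof (rule Bochner_Integration.integrable_bound)
      show "integrable lebesgue (\<lambda>x. C * ((indicator K x *\<^sub>R g x) \<bullet> b))"
        using gK unfolding set_integrable_def by (intro integrable_mult_right integrable_inner_left)
      have "continuous_on UNIV (bump_partial \<delta> y b)" by (intro continuous_intros)
      then have "bump_partial \<delta> y b \<in> borel_measurable lebesgue"
        by (intro measurable_completion) (simp add: borel_measurable_continuous_onI)
      then show "(\<lambda>x. bump_partial \<delta> y b x * ((indicator K x *\<^sub>R g x) \<bullet> b)) \<in> borel_measurable lebesgue"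
        using gK unfolding set_integrable_def
        by (intro borel_measurable_times borel_measurable_inner) auto
      show "AE x in lebesgue. norm (bump_partial \<delta> y b x * (indicator K x *\<^sub>R g x \<bullet> b))
          \<le> norm (C * (indicator K x *\<^sub>R g x \<bullet> b))"
        using C by (intro AE_I2) (auto simp: abs_mult intro!: mult_right_mono order_trans[OF C abs_ge_self])
    qed
    also have "(\<lambda>x. bump_partial \<delta> y b x * ((indicator K x *\<^sub>R g x) \<bullet> b))
        = (\<lambda>x. indicator \<Omega> x *\<^sub>R ((g x \<bullet> b) * bump_partial \<delta> y b x))"
      using K out by (auto simp: indicator_def fun_eq_iff)
    finally show ?thesis by (simp add: set_integrable_def)
  qed
  have "(LINT x:\<Omega>|lebesgue. g x \<bullet> h x)
      = (LINT x:\<Omega>|lebesgue. (\<Sum>b\<in>Basis. (g x \<bullet> b) * bump_partial \<delta> y b x))"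
    unfolding h_def by (simp add: inner_sum_right mult.commute)
  also have "\<dots> = (\<Sum>b\<in>Basis. LINT x:\<Omega>|lebesgue. (g x \<bullet> b) * bump_partial \<delta> y b x)"
    unfolding set_lebesgue_integral_def scaleR_sum_right
    by (rule Bochner_Integration.integral_sum) (rule int[unfolded set_integrable_def])
  also have "\<dots> = (\<Sum>b\<in>Basis. - (LINT x:\<Omega>|lebesgue. u x * bump_partial2 \<delta> y b x))"
  proof (rule sum.cong[OF refl])
    fix b :: 'a assume "b \<in> Basis"
    moreover have "test_function \<Omega> (bump_partial \<delta> y b)"
      unfolding test_function_def
      using supp(2) bump_algebra_smooth_on[OF bump_partial_in_algebra] by blast
    ultimately have "(LINT x:\<Omega>|lebesgue. u x * frechet_derivative (bump_partial \<delta> y b) (at x) b)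
        = - (LINT x:\<Omega>|lebesgue. (g x \<bullet> b) * bump_partial \<delta> y b x)"
      using g unfolding has_weak_gradient_def by blast
    then show "(LINT x:\<Omega>|lebesgue. (g x \<bullet> b) * bump_partial \<delta> y b x)
        = - (LINT x:\<Omega>|lebesgue. u x * bump_partial2 \<delta> y b x)"
      by (simp add: bump_partial2_def)
  qed
  finally show ?thesis
    using ineq by (simp add: sum_negf)
qed

subsection \<open>Mollification\<close>

text \<open>Taylor's formula of order two for the even function g(t) + g(-t), whose first derivative
  vanishes at 0. The exact form serves twice: it yields the limit of the quotients and a bound for
  them that is uniform in h.\<close>

lemma symmetric_second_difference:
  fixes g :: "real \<Rightarrow> real"
  assumes h: "0 < h"
    and g': "\<And>t. \<bar>t\<bar> \<le> h \<Longrightarrow> DERIV g t :> g' t"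
    and g'': "\<And>t. \<bar>t\<bar> \<le> h \<Longrightarrow> DERIV g' t :> g'' t"
  shows "\<exists>z. 0 < z \<and> z < h \<and> g h + g (- h) - 2 * g 0 = (g'' z + g'' (- z)) / 2 * h\<^sup>2"
proof -
  define D where "D m t = (if m = 0 then g t + g (- t) else
     if m = Suc 0 then g' t - g' (- t) else g'' t + g'' (- t))" for m :: nat and t
  have "DERIV (D m) t :> D (Suc m) t" if "m < 2" "0 \<le> t" "t \<le> h" for m t
  proof -
    have t: "\<bar>t\<bar> \<le> h" "\<bar>- t\<bar> \<le> h" using that by auto
    have "DERIV (\<lambda>t. g (- t)) t :> - g' (- t)" "DERIV (\<lambda>t. g' (- t)) t :> - g'' (- t)"
      using DERIV_mirror[of g "g' (- t)" t] DERIV_mirror[of g' "g'' (- t)" t]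
        g'[OF t(2)] g''[OF t(2)] by simp_all
    then show ?thesis
      using \<open>m < 2\<close> g'[OF t(1)] g''[OF t(1)]
      by (cases "m = 0") (auto simp: D_def[abs_def] less_2_cases_iff intro!: derivative_eq_intros)
  qed
  with Maclaurin[of h 2 D "D 0"] h obtain z where z: "0 < z" "z < h"
    "D 0 h = (\<Sum>m<2. D m 0 / fact m * h ^ m) + D 2 z / fact 2 * h ^ 2"
    by auto
  then show ?thesis
    by (intro exI[of _ z]) (auto simp: D_def numeral_2_eq_2)
qed

lemma symmetric_second_difference_tendsto:
  fixes g :: "real \<Rightarrow> real"
  assumes r: "0 < r"
    and g': "\<And>t. \<bar>t\<bar> < r \<Longrightarrow> DERIV g t :> g' t"
    and g'': "\<And>t. \<bar>t\<bar> < r \<Longrightarrow> DERIV g' t :> g'' t"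
    and cont: "isCont g'' 0"
  shows "((\<lambda>t. (g t + g (- t) - 2 * g 0) / t\<^sup>2) \<longlongrightarrow> g'' 0) (at_right 0)"
proof (rule tendstoI)
  fix e :: real assume "0 < e"
  then obtain d where d: "0 < d" "\<And>z. \<bar>z\<bar> < d \<Longrightarrow> \<bar>g'' z - g'' 0\<bar> < e"
    using cont unfolding continuous_at_eps_delta dist_real_def by (metis diff_zero)
  have "\<forall>\<^sub>F t in at_right 0. 0 < t \<and> t < min r d"
    using r d(1) by (auto simp: eventually_at_right_field intro!: exI[of _ "min r d"])
  then show "\<forall>\<^sub>F t in at_right 0. dist ((g t + g (- t) - 2 * g 0) / t\<^sup>2) (g'' 0) < e"
  proof eventually_elim
    fix t assume t: "0 < t \<and> t < min r d"
    then obtain z where z: "0 < z" "z < t" "g t + g (- t) - 2 * g 0 = (g'' z + g'' (- z)) / 2 * t\<^sup>2"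
      using symmetric_second_difference[of t g g' g''] g' g'' by auto
    have "\<bar>g'' z - g'' 0\<bar> < e" "\<bar>g'' (- z) - g'' 0\<bar> < e"
      using z t by (auto intro!: d(2))
    then have "\<bar>(g'' z + g'' (- z)) / 2 - g'' 0\<bar> < e"
      by (auto simp: abs_less_iff field_simps)
    moreover have "(g t + g (- t) - 2 * g 0) / t\<^sup>2 = (g'' z + g'' (- z)) / 2"
      unfolding z(3) using t by simp
    ultimately show "dist ((g t + g (- t) - 2 * g 0) / t\<^sup>2) (g'' 0) < e"
      by (simp only: dist_real_def)
  qed
qed

lemma DERIV_bump_along_line:
  "DERIV (\<lambda>t. bump \<delta> y (x + t *\<^sub>R b)) t :> bump_partial \<delta> y b (x + t *\<^sub>R b)"
  "DERIV (\<lambda>t. bump_partial \<delta> y b (x + t *\<^sub>R b)) t :> bump_partial2 \<delta> y b (x + t *\<^sub>R b)"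
  using bump_algebra_differentiable[OF bump_in_algebra, of \<delta> y "x + t *\<^sub>R b"]
    bump_algebra_differentiable[OF bump_partial_in_algebra, of \<delta> y b "x + t *\<^sub>R b"]
  unfolding frechet_derivative_works bump_partial_def[symmetric] bump_partial2_def[symmetric]
  by (auto dest: has_real_derivative_along_line simp: bump_partial_def bump_partial2_def)

definition mollify :: "'a::euclidean_space set \<Rightarrow> ('a \<Rightarrow> real) \<Rightarrow> real \<Rightarrow> 'a \<Rightarrow> real" where
  "mollify \<Omega> u \<delta> y = (LINT x:\<Omega>|lebesgue. u x * bump \<delta> y x)"

lemma mollify_integrable:
  assumes "0 \<le> \<delta>" "cball y \<delta> \<subseteq> \<Omega>" "continuous_on \<Omega> u"
  shows "set_integrable lebesgue \<Omega> (\<lambda>x. u x * bump \<delta> y x)"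
  using assms bump_eq_0[of \<delta> _ y]
  by (intro set_integrable_compact_support[of "cball y \<delta>"] continuous_intros)
    (auto intro: continuous_on_subset)

text \<open>The limit of second difference quotients stands in for the second derivative of the
  mollification, and it is exactly what a maximum controls. By translation the quotients act on the
  kernel, where dominated convergence applies.\<close>

lemma mollify_second_difference_tendsto:
  fixes y b :: "'a::euclidean_space"
  assumes u: "continuous_on \<Omega> u" and \<delta>: "0 \<le> \<delta>" and K: "cball y (\<delta> + r) \<subseteq> \<Omega>"
    and b: "norm b = 1" and t: "\<And>n. 0 < t n" "\<And>n. t n \<le> r" "t \<longlonglongrightarrow> 0"
  shows "(\<lambda>n. (mollify \<Omega> u \<delta> (y + t n *\<^sub>R b) + mollify \<Omega> u \<delta> (y - t n *\<^sub>R b)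
      - 2 * mollify \<Omega> u \<delta> y) / (t n)\<^sup>2)
    \<longlonglongrightarrow> (LINT x:\<Omega>|lebesgue. u x * bump_partial2 \<delta> y b x)"
proof -
  define q where "q n x = (bump \<delta> y (x - t n *\<^sub>R b) + bump \<delta> y (x + t n *\<^sub>R b) - 2 * bump \<delta> y x) / (t n)\<^sup>2"
    for n x
  \<comment> \<open>Contains the supports of all kernels whose centres lie within r of y.\<close>
  define K' where "K' = cball y (\<delta> + r)"
  have r: "0 < r" using t(1,2)[of 0] by linarith
  have K': "compact K'" "K' \<subseteq> \<Omega>" "continuous_on K' u"
    using K u by (auto simp: K'_def intro: continuous_on_subset)
  have sub: "cball z \<delta> \<subseteq> K'" if "dist y z \<le> r" for z
    using that unfolding K'_def
    by (auto intro!: order_trans[OF dist_triangle[of y _ z]])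
  have mem: "dist y (y + t n *\<^sub>R b) \<le> r" "dist y (y - t n *\<^sub>R b) \<le> r" for n
    using b t(1,2)[of n] by (auto simp: dist_norm)
  have out: "bump \<delta> z x = 0" if "dist y z \<le> r" "x \<notin> K'" for z x
    using bump_eq_0[OF \<delta>, of x z] sub[OF that(1)] that(2) by blast
  have q_0: "q n x = 0" if "x \<notin> K'" for n x
    using out[OF mem(1)[of n] that] out[OF mem(2)[of n] that] out[of y x] r that
      bump_translate[of \<delta> y "t n *\<^sub>R b" x] bump_translate[of \<delta> y "- t n *\<^sub>R b" x]
    by (simp add: q_def)
  have D2_0: "bump_partial2 \<delta> y b x = 0" if "x \<notin> K'" for x
    using bump_partial2_eq_0[OF \<delta>, of x y b] sub[of y] r that by force
  obtain C where C: "0 < C" "\<And>x. \<bar>bump_partial2 \<delta> y b x\<bar> \<le> C"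
    using bounded_compact_support[OF K'(1) continuous_on_bump(3) D2_0] by blast
  have cont_q: "continuous_on UNIV (q n)" for n
    using t(1)[of n] unfolding q_def[abs_def]
    by (intro continuous_intros continuous_on_compose2[OF continuous_on_bump(1)[of UNIV]]) auto
  have "(\<lambda>n. LINT x|lebesgue. indicator K' x *\<^sub>R (u x * q n x))
      \<longlonglongrightarrow> (LINT x|lebesgue. indicator K' x *\<^sub>R (u x * bump_partial2 \<delta> y b x))"
  proof (rule integral_dominated_convergence)
    have meas: "(\<lambda>x. indicator K' x *\<^sub>R (u x * v x)) \<in> borel_measurable lebesgue"
      if "continuous_on UNIV v" for v
      using K' that set_integrable_continuous_compact[of K' "\<lambda>x. u x * v x"]
      unfolding set_integrable_def
      by (intro borel_measurable_integrable)
        (auto intro!: continuous_intros intro: continuous_on_subset)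
    show "(\<lambda>x. indicator K' x *\<^sub>R (u x * bump_partial2 \<delta> y b x)) \<in> borel_measurable lebesgue"
      by (rule meas[OF continuous_on_bump(3)])
    show "(\<lambda>x. indicator K' x *\<^sub>R (u x * q n x)) \<in> borel_measurable lebesgue" for n
      by (rule meas[OF cont_q])
    show "integrable lebesgue (\<lambda>x. C * norm (indicator K' x *\<^sub>R u x))"
      using set_integrable_continuous_compact[OF K'(1,3)] unfolding set_integrable_def
      by (intro integrable_mult_right integrable_norm)
    show "AE x in lebesgue. (\<lambda>n. indicator K' x *\<^sub>R (u x * q n x))
        \<longlonglongrightarrow> indicator K' x *\<^sub>R (u x * bump_partial2 \<delta> y b x)"
    proof (rule AE_I2)
      fix x
      define g where "g s = bump \<delta> y (x + s *\<^sub>R b)" for s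
      have "isCont (\<lambda>s. bump_partial2 \<delta> y b (x + s *\<^sub>R b)) 0"
        by (intro continuous_on_interior[of UNIV] continuous_on_compose2[OF continuous_on_bump(3)[of UNIV]]
            continuous_intros) auto
      from symmetric_second_difference_tendsto[OF zero_less_one _ _ this,
          of g "\<lambda>s. bump_partial \<delta> y b (x + s *\<^sub>R b)"]
      have "((\<lambda>s. (g s + g (- s) - 2 * g 0) / s\<^sup>2) \<longlongrightarrow> bump_partial2 \<delta> y b x) (at_right 0)"
        using DERIV_bump_along_line(1)[of \<delta> y x b] DERIV_bump_along_line(2)[of \<delta> y b x]
        by (simp add: g_def[abs_def])
      moreover have "filterlim t (at_right 0) sequentially"
        using t(3) t(1) less_imp_neq[OF t(1), symmetric]
        by (auto simp: filterlim_at intro!: always_eventually)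
      ultimately have "(\<lambda>n. (g (t n) + g (- t n) - 2 * g 0) / (t n)\<^sup>2) \<longlonglongrightarrow> bump_partial2 \<delta> y b x"
        by (rule filterlim_compose)
      moreover have "(\<lambda>n. (g (t n) + g (- t n) - 2 * g 0) / (t n)\<^sup>2) = (\<lambda>n. q n x)"
        by (simp add: g_def q_def add.commute)
      ultimately show "(\<lambda>n. indicator K' x *\<^sub>R (u x * q n x))
          \<longlonglongrightarrow> indicator K' x *\<^sub>R (u x * bump_partial2 \<delta> y b x)"
        by (intro tendsto_intros) simp
    qed
    show "AE x in lebesgue. norm (indicator K' x *\<^sub>R (u x * q n x)) \<le> C * norm (indicator K' x *\<^sub>R u x)" for n
    proof (rule AE_I2)
      fix x
      define g where "g s = bump \<delta> y (x + s *\<^sub>R b)" for s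
      \<comment> \<open>The mean value form bounds the quotient by the supremum of the second
        derivative of the kernel, whatever the step \<open>t n\<close> is.\<close>
      obtain z where "g (t n) + g (- t n) - 2 * g 0
          = (bump_partial2 \<delta> y b (x + z *\<^sub>R b) + bump_partial2 \<delta> y b (x + (- z) *\<^sub>R b)) / 2 * (t n)\<^sup>2"
        using symmetric_second_difference[OF t(1)[of n], of g "\<lambda>s. bump_partial \<delta> y b (x + s *\<^sub>R b)"
            "\<lambda>s. bump_partial2 \<delta> y b (x + s *\<^sub>R b)"]
          DERIV_bump_along_line(1)[of \<delta> y x b] DERIV_bump_along_line(2)[of \<delta> y b x]
        unfolding g_def[abs_def] by blast
      then have "q n x = (bump_partial2 \<delta> y b (x + z *\<^sub>R b) + bump_partial2 \<delta> y b (x + (- z) *\<^sub>R b)) / 2"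
        using t(1)[of n] by (simp add: q_def g_def field_simps)
      then have "\<bar>q n x\<bar> \<le> C"
        using C(2)[of "x + z *\<^sub>R b"] C(2)[of "x + (- z) *\<^sub>R b"]
        by (auto simp: abs_le_iff field_simps)
      then show "norm (indicator K' x *\<^sub>R (u x * q n x)) \<le> C * norm (indicator K' x *\<^sub>R u x)"
        by (auto simp: indicator_def abs_mult mult.commute[of C] intro!: mult_left_mono)
    qed
  qed
  moreover have "(LINT x|lebesgue. indicator K' x *\<^sub>R (u x * bump_partial2 \<delta> y b x))
      = (LINT x:\<Omega>|lebesgue. u x * bump_partial2 \<delta> y b x)"
    unfolding set_lebesgue_integral_def
    using K'(2) D2_0 by (intro Bochner_Integration.integral_cong) (auto simp: indicator_def)
  moreover have "(LINT x|lebesgue. indicator K' x *\<^sub>R (u x * q n x)) =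
      (mollify \<Omega> u \<delta> (y + t n *\<^sub>R b) + mollify \<Omega> u \<delta> (y - t n *\<^sub>R b) - 2 * mollify \<Omega> u \<delta> y) / (t n)\<^sup>2" for n
  proof -
    have i: "set_integrable lebesgue \<Omega> (\<lambda>x. u x * bump \<delta> z x)" if "dist y z \<le> r" for z
      using sub[OF that] K'(2) by (intro mollify_integrable \<delta> u) auto
    note i3 = i[OF mem(1)[of n]] i[OF mem(2)[of n]] i[of y]
    have "(LINT x|lebesgue. indicator K' x *\<^sub>R (u x * q n x)) =
        (LINT x:\<Omega>|lebesgue. (u x * bump \<delta> (y + t n *\<^sub>R b) x + u x * bump \<delta> (y - t n *\<^sub>R b) x
          - 2 * (u x * bump \<delta> y x)) / (t n)\<^sup>2)"
      unfolding set_lebesgue_integral_def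
    proof (rule Bochner_Integration.integral_cong[OF refl])
      fix x
      have "u x * q n x = (u x * bump \<delta> (y + t n *\<^sub>R b) x + u x * bump \<delta> (y - t n *\<^sub>R b) x
          - 2 * (u x * bump \<delta> y x)) / (t n)\<^sup>2"
        using bump_translate[of \<delta> y "t n *\<^sub>R b" x] bump_translate[of \<delta> y "- t n *\<^sub>R b" x]
        by (simp add: q_def algebra_simps)
      then show "indicator K' x *\<^sub>R (u x * q n x) = indicator \<Omega> x *\<^sub>R
          ((u x * bump \<delta> (y + t n *\<^sub>R b) x + u x * bump \<delta> (y - t n *\<^sub>R b) x - 2 * (u x * bump \<delta> y x)) / (t n)\<^sup>2)"
        using K'(2) q_0[of x n] by (auto simp: indicator_def)
    qed
    also have "\<dots> = (mollify \<Omega> u \<delta> (y + t n *\<^sub>R b) + mollify \<Omega> u \<delta> (y - t n *\<^sub>R b)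
        - 2 * mollify \<Omega> u \<delta> y) / (t n)\<^sup>2"
      using i3 r by (simp add: mollify_def)
    finally show ?thesis .
  qed
  ultimately show ?thesis by simp
qed

lemma continuous_on_mollify:
  fixes T :: "'a::euclidean_space set"
  assumes u: "continuous_on \<Omega> u" and \<delta>: "0 \<le> \<delta>" and K: "compact K" "K \<subseteq> \<Omega>"
    and T: "\<And>y. y \<in> T \<Longrightarrow> cball y \<delta> \<subseteq> K"
  shows "continuous_on T (mollify \<Omega> u \<delta>)"
  unfolding continuous_on_sequentially
proof (intro allI ballI impI, elim conjE)
  fix X :: "nat \<Rightarrow> 'a" and y
  assume y: "y \<in> T" and X: "\<forall>n. X n \<in> T" "X \<longlonglongrightarrow> y"
  have uK: "continuous_on K u" using u K by (rule_tac continuous_on_subset)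
  have eq: "mollify \<Omega> u \<delta> z = (LINT x|lebesgue. indicator K x *\<^sub>R (u x * bump \<delta> z x))" if "z \<in> T" for z
    unfolding mollify_def set_lebesgue_integral_def
    using K(2) T[OF that] bump_eq_0[OF \<delta>, of _ z]
    by (intro Bochner_Integration.integral_cong) (auto simp: indicator_def subset_iff)
  have "(\<lambda>n. LINT x|lebesgue. indicator K x *\<^sub>R (u x * bump \<delta> (X n) x))
      \<longlonglongrightarrow> (LINT x|lebesgue. indicator K x *\<^sub>R (u x * bump \<delta> y x))"
  proof (rule integral_dominated_convergence)
    have meas: "(\<lambda>x. indicator K x *\<^sub>R (u x * bump \<delta> z x)) \<in> borel_measurable lebesgue" for z
      using set_integrable_continuous_compact[of K "\<lambda>x. u x * bump \<delta> z x"] K uK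
      unfolding set_integrable_def
      by (intro borel_measurable_integrable) (auto intro!: continuous_intros)
    show "(\<lambda>x. indicator K x *\<^sub>R (u x * bump \<delta> y x)) \<in> borel_measurable lebesgue"
      "(\<lambda>x. indicator K x *\<^sub>R (u x * bump \<delta> (X n) x)) \<in> borel_measurable lebesgue" for n
      by (fact meas)+
    show "integrable lebesgue (\<lambda>x. norm (indicator K x *\<^sub>R u x))"
      using set_integrable_continuous_compact[OF K(1) uK] unfolding set_integrable_def
      by (rule integrable_norm)
    show "AE x in lebesgue. (\<lambda>n. indicator K x *\<^sub>R (u x * bump \<delta> (X n) x))
        \<longlonglongrightarrow> indicator K x *\<^sub>R (u x * bump \<delta> y x)"
    proof (rule AE_I2)
      fix x
      have *: "bump \<delta> z x = bump \<delta> 0 (x - z)" for z :: 'a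
        using bump_translate[of \<delta> 0 z x] by simp
      have "(\<lambda>n. bump \<delta> 0 (x - X n)) \<longlonglongrightarrow> bump \<delta> 0 (x - y)"
        by (rule continuous_on_tendsto_compose[OF continuous_on_bump(1)[of UNIV]])
          (auto intro!: tendsto_intros X)
      then show "(\<lambda>n. indicator K x *\<^sub>R (u x * bump \<delta> (X n) x)) \<longlonglongrightarrow> indicator K x *\<^sub>R (u x * bump \<delta> y x)"
        by (intro tendsto_intros) (simp add: *)
    qed
    show "AE x in lebesgue. norm (indicator K x *\<^sub>R (u x * bump \<delta> (X n) x)) \<le> norm (indicator K x *\<^sub>R u x)" for n
      using bump_nonneg[of \<delta> "X n"] bump_le_1[of \<delta> "X n"]
      by (intro AE_I2) (auto simp: indicator_def abs_mult mult_left_le)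
  qed
  then show "(mollify \<Omega> u \<delta> \<circ> X) \<longlonglongrightarrow> mollify \<Omega> u \<delta> y"
    using X(1) y by (simp add: o_def eq)
qed

section \<open>Mass of the kernel and error of the mollification\<close>

lemma bump_integral_translate:
  fixes y :: "'a::euclidean_space"
  shows "(LINT x|lebesgue. bump \<delta> y x) = (LINT x|lebesgue. bump \<delta> (0::'a) x)"
proof -
  have meas: "bump \<delta> z \<in> borel_measurable borel" for z :: 'a
    by (intro borel_measurable_continuous_onI continuous_intros)
  have "(LINT x|lborel. bump \<delta> (0::'a) (x + (- y))) = (LINT x|lborel. bump \<delta> (0::'a) x)"
    by (rule lborel_integral_translate[OF meas])
  moreover have "bump \<delta> 0 (x + (- y)) = bump \<delta> y x" for x
    using bump_translate[of \<delta> 0 y x] by simp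
  ultimately show ?thesis
    using integral_completion[of "bump \<delta> y" lborel] integral_completion[of "bump \<delta> (0::'a)" lborel] meas
    by simp
qed

lemma bump_integral_pos:
  assumes "0 < \<delta>"
  shows "0 < (LINT x|lebesgue. bump \<delta> (0::'a::euclidean_space) x)"
proof -
  have cont: "isCont (bump \<delta> (0::'a)) 0"
    using continuous_on_bump(1)[of UNIV \<delta> "0::'a"] by (simp add: continuous_on_eq_continuous_at)
  \<comment> \<open>Half the central value: by continuity the bump stays above it on a small ball,
    which has positive volume.\<close>
  define c where "c = bump \<delta> (0::'a) 0 / 2"
  have c: "0 < c" using bump_pos[OF assms, of "0::'a"] by (simp add: c_def)
  then obtain e where e: "0 < e" "\<And>x::'a. norm x < e \<Longrightarrow> \<bar>bump \<delta> 0 x - bump \<delta> 0 (0::'a)\<bar> < c"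
    using cont unfolding continuous_at_eps_delta dist_norm by fastforce
  have int: "integrable lborel (bump \<delta> (0::'a))"
  proof -
    have "integrable lborel (\<lambda>x. indicator (cball 0 \<delta>) x *\<^sub>R bump \<delta> (0::'a) x)"
      by (intro borel_integrable_compact continuous_intros) auto
    moreover have "(\<lambda>x. indicator (cball 0 \<delta>) x *\<^sub>R bump \<delta> (0::'a) x) = bump \<delta> 0"
      using bump_eq_0[of \<delta> _ "0::'a"] assms by (auto simp: indicator_def fun_eq_iff)
    ultimately show ?thesis by simp
  qed
  have "0 < c * measure lborel (ball (0::'a) e)"
    using c e(1) by (simp add: content_ball_pos)
  also have "\<dots> = (LINT x|lborel. c * indicator (ball (0::'a) e) x)"
    by simp
  also have "\<dots> \<le> (LINT x|lborel. bump \<delta> (0::'a) x)"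
  proof (rule integral_mono[OF _ int])
    show "integrable lborel (\<lambda>x. c * indicator (ball (0::'a) e) x)"
      using emeasure_lborel_ball_finite[of "0::'a" e]
      by (intro integrable_mult_right integrable_real_indicator) auto
    show "c * indicator (ball (0::'a) e) x \<le> bump \<delta> 0 x" for x :: 'a
    proof (cases "norm x < e")
      case True
      have "bump \<delta> 0 (0::'a) = 2 * c" by (simp add: c_def)
      then show ?thesis using e(2)[OF True] c True by (simp add: abs_if split: if_splits)
    qed (simp add: bump_nonneg)
  qed
  also have "\<dots> = (LINT x|lebesgue. bump \<delta> (0::'a) x)"
    by (rule integral_completion[symmetric]) (simp add: borel_measurable_continuous_onI continuous_on_bump)
  finally show ?thesis .
qed

text \<open>The kernel is nonnegative, so bounds for u on its support integrate to bounds for the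
  mollification. The mass of the kernel appears as a factor because \<open>mollify\<close> is not
  normalised. The lemma is applied both to u and to u/d^2.\<close>

lemma mollify_approx:
  fixes y :: "'a::euclidean_space"
  assumes u: "continuous_on \<Omega> u" and \<delta>: "0 \<le> \<delta>" "cball y \<delta> \<subseteq> \<Omega>"
    and close: "\<And>x. x \<in> cball y \<delta> \<Longrightarrow> \<bar>u x - c\<bar> \<le> \<eta>"
  shows "\<bar>mollify \<Omega> u \<delta> y - c * (LINT x|lebesgue. bump \<delta> (0::'a) x)\<bar>
    \<le> \<eta> * (LINT x|lebesgue. bump \<delta> (0::'a) x)"
proof -
  have mass: "(LINT x|lebesgue. bump \<delta> (0::'a) x) = (LINT x:\<Omega>|lebesgue. bump \<delta> y x)"
    unfolding bump_integral_translate[of \<delta> y, symmetric] set_lebesgue_integral_def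
    using bump_eq_0[of \<delta> _ y] \<delta>
    by (intro Bochner_Integration.integral_cong) (auto simp: indicator_def subset_iff)
  have int_u: "set_integrable lebesgue \<Omega> (\<lambda>x. u x * bump \<delta> y x)"
    by (rule mollify_integrable[OF \<delta> u])
  have int_1: "set_integrable lebesgue \<Omega> (bump \<delta> y)"
    using mollify_integrable[OF \<delta>, of "\<lambda>_. 1"] by simp
  have bound: "(c - \<eta>) * bump \<delta> y x \<le> u x * bump \<delta> y x \<and> u x * bump \<delta> y x \<le> (c + \<eta>) * bump \<delta> y x" for x
  proof (cases "x \<in> cball y \<delta>")
    case True
    then show ?thesis
      using close[OF True] bump_nonneg[of \<delta> y x]
      by (auto intro!: mult_right_mono simp: abs_le_iff)
  next
    case False
    then show ?thesis using bump_eq_0[OF \<delta>(1) False] by simp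
  qed
  have "(LINT x:\<Omega>|lebesgue. (c - \<eta>) * bump \<delta> y x) \<le> mollify \<Omega> u \<delta> y"
    unfolding mollify_def using int_u int_1 bound by (intro set_integral_mono) auto
  moreover have "mollify \<Omega> u \<delta> y \<le> (LINT x:\<Omega>|lebesgue. (c + \<eta>) * bump \<delta> y x)"
    unfolding mollify_def using int_u int_1 bound by (intro set_integral_mono) auto
  ultimately show ?thesis
    unfolding mass set_integral_mult_right by (simp add: abs_le_iff left_diff_distrib distrib_right)
qed

subsection \<open>The distance to the boundary of a convex domain\<close>

lemma bdist_pos:
  assumes "open \<Omega>" "bounded \<Omega>" "x \<in> \<Omega>"
  shows "0 < bdist \<Omega> x"
proof -
  \<comment> \<open>\<open>infdist\<close> to the empty set is 0, so positivity depends on this: a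
    nonempty bounded open set is not the whole space and hence has boundary points.\<close>
  have "frontier \<Omega> \<noteq> {}"
    using assms not_bounded_UNIV by (auto simp: frontier_eq_empty)
  moreover have "x \<notin> frontier \<Omega>"
    using assms by (simp add: frontier_def interior_open)
  ultimately show ?thesis
    unfolding bdist_def by (intro infdist_pos_not_in_closed) auto
qed

text \<open>A ball is connected; if it left \<Omega> it would meet the boundary at a distance from x
  smaller than the minimal one.\<close>

lemma ball_bdist_subset:
  assumes "x \<in> \<Omega>"
  shows "ball x (bdist \<Omega> x) \<subseteq> \<Omega>"
proof (rule ccontr)
  assume "\<not> ball x (bdist \<Omega> x) \<subseteq> \<Omega>"
  then obtain w where w: "w \<in> ball x (bdist \<Omega> x)" "w \<notin> \<Omega>" by blast
  then have "0 < bdist \<Omega> x" by (auto intro: le_less_trans[OF zero_le_dist])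
  then have "x \<in> ball x (bdist \<Omega> x)" by simp
  with w assms have "ball x (bdist \<Omega> x) \<inter> frontier \<Omega> \<noteq> {}"
    by (intro connected_Int_frontier connected_ball) blast+
  then obtain z where "z \<in> frontier \<Omega>" "dist x z < bdist \<Omega> x" by auto
  then show False
    using infdist_le[of z "frontier \<Omega>" x] by (simp add: bdist_def)
qed

text \<open>The affine function is the signed distance to a hyperplane supporting \<^term>\<open>\<Omega>\<close> at a boundary
  point nearest to \<^term>\<open>x\<close>.\<close>

lemma bdist_le_affine:
  fixes \<Omega> :: "'a::euclidean_space set"
  assumes \<Omega>: "open \<Omega>" "bounded \<Omega>" "convex \<Omega>" and x: "x \<in> \<Omega>"
  shows "\<exists>a. norm a = 1 \<and> (\<forall>z\<in>\<Omega>. bdist \<Omega> z \<le> bdist \<Omega> x + a \<bullet> (z - x))"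
proof -
  have "frontier \<Omega> \<noteq> {}"
    using \<Omega> x not_bounded_UNIV by (auto simp: frontier_eq_empty)
  then obtain y where y: "y \<in> frontier \<Omega>" "bdist \<Omega> x = dist x y"
    using infdist_attains_inf[OF frontier_closed] unfolding bdist_def by metis
  have "y \<notin> \<Omega>" using y(1) \<Omega>(1) by (simp add: frontier_def interior_open)
  then obtain a0 c where a0: "a0 \<noteq> 0" "a0 \<bullet> y \<le> c" "\<And>z. z \<in> \<Omega> \<Longrightarrow> c \<le> a0 \<bullet> z"
    using separating_hyperplane_sets[of "{y}" \<Omega>] \<Omega> x by auto
  define a where "a = a0 /\<^sub>R norm a0"
  have a: "norm a = 1" using a0(1) by (simp add: a_def)
  then have "a \<bullet> a = 1" by (simp add: norm_eq_1)
  note a = a this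
  have pos: "a \<bullet> y \<le> a \<bullet> z" if "z \<in> \<Omega>" for z
    using a0(2) a0(3)[OF that] a0(1) by (simp add: a_def)
  have strict: "a \<bullet> y < a \<bullet> z" if z: "z \<in> \<Omega>" for z
  proof -
    obtain e where e: "0 < e" "cball z e \<subseteq> \<Omega>"
      using \<Omega>(1) z open_contains_cball by blast
    then have "z - e *\<^sub>R a \<in> \<Omega>" using a by (auto simp: dist_norm)
    from pos[OF this] e(1) a show ?thesis by (simp add: inner_diff_right)
  qed
  have x_far: "bdist \<Omega> x \<le> a \<bullet> (x - y)"
  proof (rule field_le_epsilon)
    fix e :: real assume "0 < e"
    define s where "s = max 0 (bdist \<Omega> x - e)"
    have "s < bdist \<Omega> x" "0 \<le> s"
      using \<open>0 < e\<close> bdist_pos[OF \<Omega>(1,2) x] by (auto simp: s_def)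
    then have "x - s *\<^sub>R a \<in> ball x (bdist \<Omega> x)" using a by (simp add: dist_norm)
    then have "x - s *\<^sub>R a \<in> \<Omega>" using ball_bdist_subset[OF x] by blast
    from pos[OF this] show "bdist \<Omega> x \<le> a \<bullet> (x - y) + e"
      using a by (simp add: inner_diff_right s_def)
  qed
  \<comment> \<open>Here y enters as a nearest boundary point: |x - y| equals the distance of x to
    the boundary, so the height of x above the hyperplane is no larger.\<close>
  have le: "a \<bullet> (x - y) \<le> bdist \<Omega> x"
    using norm_cauchy_schwarz[of a "x - y"] a y(2) by (simp add: dist_norm)
  have "bdist \<Omega> z \<le> bdist \<Omega> x + a \<bullet> (z - x)" if z: "z \<in> \<Omega>" for z
  proof -
    \<comment> \<open>s is the height of z above the supporting hyperplane. Descending from z by s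
      along -a reaches the hyperplane, which is disjoint from \<Omega>, so the boundary is met on
      the way.\<close>
    define s where "s = a \<bullet> (z - y)"
    have s: "0 < s" using strict[OF z] by (simp add: s_def inner_diff_right)
    have "a \<bullet> (z - s *\<^sub>R a) = a \<bullet> y" using a by (simp add: s_def inner_diff_right)
    then have "z - s *\<^sub>R a \<notin> \<Omega>" using strict by fastforce
    then have "closed_segment z (z - s *\<^sub>R a) \<inter> frontier \<Omega> \<noteq> {}"
      using z by (intro connected_Int_frontier) auto
    then obtain w where w: "w \<in> closed_segment z (z - s *\<^sub>R a)" "w \<in> frontier \<Omega>" by blast
    have "bdist \<Omega> z \<le> dist z w" using w(2) by (simp add: bdist_def infdist_le)
    also have "\<dots> \<le> dist z (z - s *\<^sub>R a)"
      using segment_bound(1)[OF w(1)] by (simp add: dist_norm norm_minus_commute)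
    also have "\<dots> = s" using s a by (simp add: dist_norm)
    also have "s = a \<bullet> (x - y) + a \<bullet> (z - x)" by (simp add: s_def inner_diff_right)
    finally show ?thesis using le by simp
  qed
  with a show ?thesis by blast
qed

subsection \<open>The barrier and the comparison principle\<close>

text \<open>The functions \<^term>\<open>\<lambda>t. sqrt t * (M - ln t)\<close> solve $\phi'' + \phi/(4t^2) = 0$; the extra
  summand \<^term>\<open>- t * sqrt t\<close> makes the barrier a strict supersolution.\<close>

definition barrier :: "real \<Rightarrow> real \<Rightarrow> real" where
  "barrier M t = sqrt t * (M - ln t - t)"

definition barrier' :: "real \<Rightarrow> real \<Rightarrow> real" where
  "barrier' M t = ((M - ln t - t) / 2 - 1 - t) / sqrt t"

text \<open>Written through \<open>barrier\<close> so that the differential equation is the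
  definition itself; the computation is then the proof that this is the derivative of
  \<open>barrier'\<close>.\<close>

definition barrier'' :: "real \<Rightarrow> real \<Rightarrow> real" where
  "barrier'' M t = - barrier M t / (4 * t\<^sup>2) - 1 / sqrt t"

lemma DERIV_barrier:
  assumes "0 < t"
  shows "DERIV (barrier M) t :> barrier' M t"
proof -
  \<comment> \<open>With t = r * r, and the logarithm replaced by a free variable l, the identity
    becomes one between rational expressions.\<close>
  define r where "r = sqrt t"
  have r: "0 < r" "t = r * r" using assms by (auto simp: r_def)
  have "DERIV (\<lambda>t. M - ln t - t) t :> - (1 / t) - 1"
    using assms by (auto intro!: derivative_eq_intros)
  from DERIV_mult[OF DERIV_real_sqrt[OF assms] this]
  have "DERIV (barrier M) t :> inverse r / 2 * (M - ln t - t) + (- (1 / t) - 1) * r"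
    by (simp add: barrier_def[abs_def] r_def)
  moreover have "inverse r / 2 * (M - l - r * r) + (- (1 / (r * r)) - 1) * r
      = ((M - l - r * r) / 2 - 1 - r * r) / r" for l
    using r(1) by (simp add: field_simps)
  ultimately show ?thesis
    using r by (simp add: barrier'_def flip: r_def)
qed

lemma DERIV_barrier':
  assumes "0 < t"
  shows "DERIV (barrier' M) t :> barrier'' M t"
proof -
  define r where "r = sqrt t"
  have r: "0 < r" "t = r * r" using assms by (auto simp: r_def)
  have "DERIV (\<lambda>t. (M - ln t - t) / 2 - 1 - t) t :> (- (1 / t) - 1) / 2 - 1"
    using assms by (auto intro!: derivative_eq_intros)
  from DERIV_divide[OF this DERIV_real_sqrt[OF assms]]
  have "DERIV (barrier' M) t :> (((- (1 / t) - 1) / 2 - 1) * r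
      - ((M - ln t - t) / 2 - 1 - t) * (inverse r / 2)) / (r * r)"
    using r(1) by (simp add: barrier'_def[abs_def] r_def)
  moreover have "(((- (1 / (r * r)) - 1) / 2 - 1) * r
      - ((M - l - r * r) / 2 - 1 - r * r) * (inverse r / 2)) / (r * r)
      = - (r * (M - l - r * r)) / (4 * (r * r)\<^sup>2) - 1 / r" for l
    using r(1) by (simp add: field_simps power2_eq_square)
  ultimately show ?thesis
    using r by (simp add: barrier''_def barrier_def flip: r_def)
qed

text \<open>The derivative is nonnegative as soon as M \<ge> ln t + 3 t + 2. Since t \<le> R and ln
  t \<le> t - 1 \<le> R, the value 4 * R + 2 is large enough; it also makes the barrier
  positive.\<close>

lemma barrier_pos_mono:
  assumes "1 \<le> R"
  shows "0 < t \<Longrightarrow> t \<le> R \<Longrightarrow> 0 < barrier (4 * R + 2) t"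
    and "0 < s \<Longrightarrow> s \<le> t \<Longrightarrow> t \<le> R \<Longrightarrow> barrier (4 * R + 2) s \<le> barrier (4 * R + 2) t"
proof -
  have ln: "ln t \<le> R" if "0 < t" "t \<le> R" for t
    using ln_le_minus_one[of t] that by linarith
  show "0 < barrier (4 * R + 2) t" if "0 < t" "t \<le> R" for t
    using that ln[OF that] assms by (auto simp: barrier_def intro!: mult_pos_pos)
  show "barrier (4 * R + 2) s \<le> barrier (4 * R + 2) t" if "0 < s" "s \<le> t" "t \<le> R" for s t
  proof (rule DERIV_nonneg_imp_nondecreasing[OF that(2)])
    fix z assume z: "s \<le> z" "z \<le> t"
    then have "0 \<le> (4 * R + 2 - ln z - z) / 2 - 1 - z"
      using that ln[of z] by (simp add: field_simps)
    then have "0 \<le> barrier' (4 * R + 2) z"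
      using that z unfolding barrier'_def by (intro divide_nonneg_nonneg) auto
    then show "\<exists>y. DERIV (barrier (4 * R + 2)) z :> y \<and> 0 \<le> y"
      using DERIV_barrier[of z] that z by auto
  qed
qed

lemma continuous_on_barrier [continuous_intros]:
  assumes "continuous_on A f" "\<And>x. x \<in> A \<Longrightarrow> 0 < f x"
  shows "continuous_on A (\<lambda>x. barrier M (f x))"
  unfolding barrier_def by (intro continuous_intros assms) (use assms(2) in force)

lemma eventually_to_boundary:
  "eventually P (to_boundary \<Omega>) \<longleftrightarrow> (\<exists>a>0. \<forall>x\<in>\<Omega>. 0 < bdist \<Omega> x \<longrightarrow> bdist \<Omega> x < a \<longrightarrow> P x)"
proof
  assume "eventually P (to_boundary \<Omega>)"
  then obtain Q where "eventually Q (at_right 0)" "\<And>x. x \<in> \<Omega> \<Longrightarrow> Q (bdist \<Omega> x) \<Longrightarrow> P x"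
    unfolding to_boundary_def eventually_inf_principal eventually_filtercomap by blast
  then show "\<exists>a>0. \<forall>x\<in>\<Omega>. 0 < bdist \<Omega> x \<longrightarrow> bdist \<Omega> x < a \<longrightarrow> P x"
    unfolding eventually_at_right_field by metis
next
  assume "\<exists>a>0. \<forall>x\<in>\<Omega>. 0 < bdist \<Omega> x \<longrightarrow> bdist \<Omega> x < a \<longrightarrow> P x"
  then obtain a where "a > 0" "\<forall>x\<in>\<Omega>. 0 < bdist \<Omega> x \<longrightarrow> bdist \<Omega> x < a \<longrightarrow> P x" by blast
  then show "eventually P (to_boundary \<Omega>)"
    unfolding to_boundary_def eventually_inf_principal eventually_filtercomap
    by (intro exI[of _ "\<lambda>t. 0 < t \<and> t < a"]) (auto simp: eventually_at_right_field)
qed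

text \<open>A point of the closure outside \<Omega> lies on the boundary, where the distance is 0.
  The set is therefore unchanged when \<Omega> is replaced by its compact closure.\<close>

lemma compact_bdist_ge:
  assumes "open \<Omega>" "bounded \<Omega>" "0 < a"
  shows "compact {x \<in> \<Omega>. a \<le> bdist \<Omega> x}"
proof -
  have "{x \<in> \<Omega>. a \<le> bdist \<Omega> x} = closure \<Omega> \<inter> {x. a \<le> bdist \<Omega> x}"
  proof -
    have "x \<in> \<Omega>" if "x \<in> closure \<Omega>" "a \<le> bdist \<Omega> x" for x
    proof (rule ccontr)
      assume "x \<notin> \<Omega>"
      then have "x \<in> frontier \<Omega>" using that(1) assms(1) by (simp add: frontier_def interior_open)
      then show False using that(2) \<open>0 < a\<close> by (simp add: bdist_def)
    qed
    then show ?thesis using closure_subset by auto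
  qed
  moreover have "closed {x. a \<le> bdist \<Omega> x}"
    unfolding bdist_def by (intro closed_Collect_le continuous_intros)
  ultimately show ?thesis
    using assms by (auto simp: compact_closure intro: compact_Int_closed)
qed

text \<open>In a basis direction b the second differences of the mollification are at most c times
  those of the barrier along the affine majorant, which tend to \<open>barrier''\<close> times the
  square of a \<bullet> b. These squares sum to 1 because a is a unit vector, so the sum over
  \<open>Basis\<close> returns \<open>barrier''\<close> itself.\<close>

lemma barrier_touching_inequality:
  fixes \<Omega> :: "'a::euclidean_space set"
  assumes \<Omega>: "open \<Omega>" "bounded \<Omega>" "convex \<Omega>"
    and R: "1 \<le> R" "\<And>x. x \<in> \<Omega> \<Longrightarrow> bdist \<Omega> x + 1 \<le> R" and M: "M = 4 * R + 2"
    and u: "continuous_on \<Omega> u" and y: "y \<in> \<Omega>" and \<delta>: "0 \<le> \<delta>"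
    and r: "0 < r" "\<delta> + r < bdist \<Omega> y" "r \<le> 1" and c: "0 \<le> c"
    and max: "\<And>z. dist y z \<le> r \<Longrightarrow>
      mollify \<Omega> u \<delta> z - c * barrier M (bdist \<Omega> z) \<le> mollify \<Omega> u \<delta> y - c * barrier M (bdist \<Omega> y)"
  shows "(\<Sum>b\<in>Basis. LINT x:\<Omega>|lebesgue. u x * bump_partial2 \<delta> y b x) \<le> c * barrier'' M (bdist \<Omega> y)"
proof -
  define \<rho> where "\<rho> = bdist \<Omega> y"
  obtain a where a: "norm a = 1" "\<And>z. z \<in> \<Omega> \<Longrightarrow> bdist \<Omega> z \<le> \<rho> + a \<bullet> (z - y)"
    using bdist_le_affine[OF \<Omega> y] unfolding \<rho>_def by blast
  have \<rho>: "r < \<rho>" "0 < \<rho>" using r \<delta> by (auto simp: \<rho>_def)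
  have sub: "cball y (\<delta> + r) \<subseteq> \<Omega>"
    using r(2) ball_bdist_subset[OF y] by force
  define t where "t n = r / real (Suc n)" for n
  have t: "0 < t n" "t n \<le> r" for n
    using r(1) by (auto simp: t_def field_simps)
  have t_lim: "t \<longlonglongrightarrow> 0"
    unfolding t_def using LIMSEQ_Suc[OF lim_const_over_n[of r]] by simp
  have "(LINT x:\<Omega>|lebesgue. u x * bump_partial2 \<delta> y b x) \<le> c * (barrier'' M \<rho> * (a \<bullet> b)\<^sup>2)"
    if b: "b \<in> Basis" for b
  proof (rule LIMSEQ_le)
    have ab: "\<bar>a \<bullet> b\<bar> \<le> 1" using Cauchy_Schwarz_ineq2[of a b] a(1) b by simp
    show "(\<lambda>n. (mollify \<Omega> u \<delta> (y + t n *\<^sub>R b) + mollify \<Omega> u \<delta> (y - t n *\<^sub>R b)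
      - 2 * mollify \<Omega> u \<delta> y) / (t n)\<^sup>2) \<longlonglongrightarrow> (LINT x:\<Omega>|lebesgue. u x * bump_partial2 \<delta> y b x)"
      using b by (intro mollify_second_difference_tendsto[OF u \<delta> sub _ t t_lim]) auto
    define g where "g s = barrier M (\<rho> + s * (a \<bullet> b))" for s
    define g' where "g' s = barrier' M (\<rho> + s * (a \<bullet> b)) * (a \<bullet> b)" for s
    define g'' where "g'' s = barrier'' M (\<rho> + s * (a \<bullet> b)) * (a \<bullet> b)\<^sup>2" for s
    have arg: "\<bar>s * (a \<bullet> b)\<bar> \<le> \<bar>s\<bar>" for s
      using ab by (simp add: abs_mult mult_left_le)
    have pos: "0 < \<rho> + s * (a \<bullet> b)" if "\<bar>s\<bar> < \<rho>" for s
      using arg[of s] that by linarith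
    have aff: "DERIV (\<lambda>s. \<rho> + s * (a \<bullet> b)) s :> a \<bullet> b" for s
      by (auto intro!: derivative_eq_intros)
    have "((\<lambda>s. (g s + g (- s) - 2 * g 0) / s\<^sup>2) \<longlongrightarrow> g'' 0) (at_right 0)"
    proof (rule symmetric_second_difference_tendsto[OF \<rho>(2)])
      show "DERIV g s :> g' s" if "\<bar>s\<bar> < \<rho>" for s
        unfolding g_def[abs_def] g'_def by (rule DERIV_chain2[OF DERIV_barrier[OF pos[OF that]] aff])
      show "DERIV g' s :> g'' s" if "\<bar>s\<bar> < \<rho>" for s
        using DERIV_cmult_right[OF DERIV_chain2[OF DERIV_barrier'[OF pos[OF that], of M] aff], of "a \<bullet> b"]
        unfolding g'_def[abs_def] g''_def by (simp add: power2_eq_square mult.assoc)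
      show "isCont g'' 0"
        using \<rho>(2) unfolding g''_def[abs_def] barrier''_def barrier_def
        by (intro continuous_intros) auto
    qed
    then have "(\<lambda>n. (g (t n) + g (- t n) - 2 * g 0) / (t n)\<^sup>2) \<longlonglongrightarrow> g'' 0"
    proof (rule filterlim_compose)
      show "filterlim t (at_right 0) sequentially"
        using t_lim t(1) less_imp_neq[OF t(1), symmetric]
        by (auto simp: filterlim_at intro!: always_eventually)
    qed
    then show "(\<lambda>n. c * ((g (t n) + g (- t n) - 2 * g 0) / (t n)\<^sup>2)) \<longlonglongrightarrow> c * (barrier'' M \<rho> * (a \<bullet> b)\<^sup>2)"
      by (intro tendsto_mult tendsto_const) (simp add: g''_def)
    have "(mollify \<Omega> u \<delta> (y + t n *\<^sub>R b) + mollify \<Omega> u \<delta> (y - t n *\<^sub>R b) - 2 * mollify \<Omega> u \<delta> y) / (t n)\<^sup>2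
        \<le> c * ((g (t n) + g (- t n) - 2 * g 0) / (t n)\<^sup>2)" for n
    proof -
      have bar: "mollify \<Omega> u \<delta> (y + s *\<^sub>R b) - mollify \<Omega> u \<delta> y \<le> c * (g s - g 0)" if s: "\<bar>s\<bar> \<le> r" for s
      proof -
        define z where "z = y + s *\<^sub>R b"
        have dist: "dist y z \<le> r" using s b by (simp add: z_def dist_norm)
        then have z: "z \<in> \<Omega>" using sub \<delta> by auto
        have "bdist \<Omega> z \<le> \<rho> + s * (a \<bullet> b)"
          using a(2)[OF z] by (simp add: z_def)
        \<comment> \<open>The spare 1 in the choice of R, together with r \<le> 1, keeps the affine
          majorant in the range where the barrier is monotone.\<close>
        moreover have "\<rho> + s * (a \<bullet> b) \<le> R"
          using arg[of s] s r(3) R(2)[OF y] by (simp add: \<rho>_def)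
        ultimately have "barrier M (bdist \<Omega> z) \<le> g s"
          using barrier_pos_mono(2)[OF R(1) bdist_pos[OF \<Omega>(1,2) z]] by (simp add: g_def M)
        then have "c * barrier M (bdist \<Omega> z) \<le> c * g s"
          using c by (rule mult_left_mono)
        moreover have "g 0 = barrier M (bdist \<Omega> y)" by (simp add: g_def \<rho>_def)
        ultimately show ?thesis
          using max[OF dist] by (simp add: z_def[symmetric] right_diff_distrib)
      qed
      have "mollify \<Omega> u \<delta> (y + t n *\<^sub>R b) + mollify \<Omega> u \<delta> (y - t n *\<^sub>R b) - 2 * mollify \<Omega> u \<delta> y
          \<le> c * (g (t n) + g (- t n) - 2 * g 0)"
        using bar[of "t n"] bar[of "- t n"] t[of n] by (simp add: algebra_simps)
      then show ?thesis
        by (simp add: divide_right_mono)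
    qed
    then show "\<exists>N. \<forall>n\<ge>N. (mollify \<Omega> u \<delta> (y + t n *\<^sub>R b) + mollify \<Omega> u \<delta> (y - t n *\<^sub>R b)
        - 2 * mollify \<Omega> u \<delta> y) / (t n)\<^sup>2 \<le> c * ((g (t n) + g (- t n) - 2 * g 0) / (t n)\<^sup>2)"
      by blast
  qed
  then have "(\<Sum>b\<in>Basis. LINT x:\<Omega>|lebesgue. u x * bump_partial2 \<delta> y b x)
      \<le> (\<Sum>b\<in>Basis. c * (barrier'' M \<rho> * (a \<bullet> b)\<^sup>2))"
    by (rule sum_mono)
  also have "\<dots> = c * barrier'' M \<rho> * (\<Sum>b\<in>Basis. (a \<bullet> b)\<^sup>2)"
    by (simp add: sum_distrib_left mult.assoc)
  also have "(\<Sum>b\<in>Basis. (a \<bullet> b)\<^sup>2) = 1"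
    using euclidean_inner[of a a] a(1) by (simp add: power2_eq_square norm_eq_1)
  finally show ?thesis by (simp add: \<rho>_def)
qed

theorem proposition2p13:
  fixes \<Omega> :: "'a::euclidean_space set" and u :: "'a \<Rightarrow> real"
  assumes "DIM('a) \<ge> 2"
    and "open \<Omega>" and "\<Omega> \<noteq> {}" and "bounded \<Omega>" and "convex \<Omega>" and "smooth_boundary \<Omega>"
    and "u \<in> H1_loc \<Omega>" and "continuous_on \<Omega> u"
    and "L_quarter_subharmonic \<Omega> u"
    and "Limsup (to_boundary \<Omega>)
           (\<lambda>x. ereal (u x / (sqrt (bdist \<Omega> x) * \<bar>ln (bdist \<Omega> x)\<bar>))) \<le> 0"
  shows "\<forall>x\<in>\<Omega>. u x \<le> 0"
proof (rule ccontr)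
  assume "\<not> (\<forall>x\<in>\<Omega>. u x \<le> 0)"
  then obtain x1 where x1: "x1 \<in> \<Omega>" "0 < u x1" by force
  note \<Omega> = \<open>open \<Omega>\<close> \<open>bounded \<Omega>\<close> \<open>convex \<Omega>\<close>
  note u = \<open>continuous_on \<Omega> u\<close>
  define d where "d = bdist \<Omega>"
  have d_pos: "0 < d x" if "x \<in> \<Omega>" for x
    using bdist_pos[OF \<Omega>(1,2) that] by (simp add: d_def)
  have d_cont [continuous_intros]: "continuous_on A d" for A
    unfolding d_def bdist_def by (intro continuous_intros)
  have d_lip: "\<bar>d x - d z\<bar> \<le> dist x z" for x z
    unfolding d_def bdist_def by (rule infdist_triangle_abs)
  have d_ball: "ball x (d x) \<subseteq> \<Omega>" if "x \<in> \<Omega>" for x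
    using ball_bdist_subset[OF that] by (simp add: d_def)
  obtain R where R: "1 \<le> R" "\<And>x. x \<in> \<Omega> \<Longrightarrow> d x + 1 \<le> R"
  proof -
    have "bounded (d ` closure \<Omega>)"
      using \<Omega>(2) by (intro compact_imp_bounded compact_continuous_image d_cont) (simp add: compact_closure)
    then obtain B where "\<forall>x\<in>closure \<Omega>. \<bar>d x\<bar> \<le> B" by (auto simp: bounded_iff)
    then have "d x + 1 \<le> \<bar>B\<bar> + 1" if "x \<in> \<Omega>" for x
      using that closure_subset[of \<Omega>] by fastforce
    then show thesis using that[of "\<bar>B\<bar> + 1"] by simp
  qed
  define M where "M = 4 * R + 2"
  define v where "v x = barrier M (d x)" for x
  have d_le_R: "d x \<le> R" if "x \<in> \<Omega>" for x using R(2)[OF that] by simp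
  have v_pos: "0 < v x" if "x \<in> \<Omega>" for x
    using barrier_pos_mono(1)[OF R(1) d_pos[OF that] d_le_R[OF that]] by (simp add: v_def M_def)
  have v_cont: "continuous_on \<Omega> v"
    unfolding v_def by (intro continuous_intros d_pos)
  define \<kappa>\<^sub>1 where "\<kappa>\<^sub>1 = u x1 / v x1"
  have \<kappa>\<^sub>1: "0 < \<kappa>\<^sub>1" using x1 v_pos by (simp add: \<kappa>\<^sub>1_def)

  \<comment> \<open>The positive maximum of the ratio of u to the barrier\<close>
  obtain a0 where a0: "0 < a0" "\<And>x. x \<in> \<Omega> \<Longrightarrow> d x < a0 \<Longrightarrow> u x \<le> \<kappa>\<^sub>1 / 2 * v x"
  proof -
    have "\<forall>\<^sub>F x in to_boundary \<Omega>.
        ereal (u x / (sqrt (bdist \<Omega> x) * \<bar>ln (bdist \<Omega> x)\<bar>)) < ereal (\<kappa>\<^sub>1 / 2)"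
      using \<open>Limsup _ _ \<le> 0\<close> \<kappa>\<^sub>1 by (intro Limsup_lessD) (auto elim: le_less_trans)
    then obtain a where a: "0 < a" "\<And>x. x \<in> \<Omega> \<Longrightarrow> d x < a \<Longrightarrow> u x / (sqrt (d x) * \<bar>ln (d x)\<bar>) < \<kappa>\<^sub>1 / 2"
      using d_pos unfolding eventually_to_boundary d_def by auto
    \<comment> \<open>Below distance 1 the logarithm is negative and M - d is nonnegative, so the
      barrier dominates sqrt d |ln d| and the boundary condition carries over to it.\<close>
    show thesis
    proof (rule that[of "min a 1"])
      show "0 < min a 1" using a(1) by simp
      fix x assume x: "x \<in> \<Omega>" "d x < min a 1"
      have ln: "ln (d x) < 0" using x d_pos[OF x(1)] by simp
      then have pos: "0 < sqrt (d x) * \<bar>ln (d x)\<bar>"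
        using d_pos[OF x(1)] by (intro mult_pos_pos) auto
      have "u x < \<kappa>\<^sub>1 / 2 * (sqrt (d x) * \<bar>ln (d x)\<bar>)"
        using a(2)[OF x(1)] x(2) pos by (simp add: pos_divide_less_eq)
      also have "sqrt (d x) * \<bar>ln (d x)\<bar> \<le> v x"
        using ln d_pos[OF x(1)] d_le_R[OF x(1)] R(1) unfolding v_def barrier_def M_def
        by (intro mult_left_mono) auto
      finally show "u x \<le> \<kappa>\<^sub>1 / 2 * v x" using \<kappa>\<^sub>1 by simp
    qed
  qed
  define K0 where "K0 = {x \<in> \<Omega>. a0 \<le> d x}"
  have K0: "compact K0" "K0 \<subseteq> \<Omega>"
    using compact_bdist_ge[OF \<Omega>(1,2) a0(1)] by (auto simp: K0_def d_def)
  have "x1 \<in> K0"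
  proof (rule ccontr)
    assume "x1 \<notin> K0"
    then have "u x1 \<le> \<kappa>\<^sub>1 / 2 * v x1" using a0(2) x1 by (auto simp: K0_def)
    also have "\<dots> < \<kappa>\<^sub>1 * v x1" using \<kappa>\<^sub>1 v_pos[OF x1(1)] by simp
    finally show False using v_pos[OF x1(1)] by (simp add: \<kappa>\<^sub>1_def)
  qed
  moreover have "v x \<noteq> 0" if "x \<in> K0" for x
    using that K0(2) v_pos[of x] by auto
  then have "continuous_on K0 (\<lambda>x. u x / v x)"
    using K0(2) u v_cont by (intro continuous_intros) (auto intro: continuous_on_subset)
  ultimately obtain x0 where x0: "x0 \<in> K0" "\<And>x. x \<in> K0 \<Longrightarrow> u x / v x \<le> u x0 / v x0"
    using continuous_attains_sup[OF K0(1), of "\<lambda>x. u x / v x"] by auto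
  define \<kappa> where "\<kappa> = u x0 / v x0"
  have \<kappa>: "\<kappa>\<^sub>1 \<le> \<kappa>" "0 < \<kappa>"
    using x0(2)[OF \<open>x1 \<in> K0\<close>] \<kappa>\<^sub>1 by (auto simp: \<kappa>_def \<kappa>\<^sub>1_def)
  have near: "u x \<le> \<kappa> / 2 * v x" if "x \<in> \<Omega>" "d x < a0" for x
  proof -
    have "\<kappa>\<^sub>1 / 2 * v x \<le> \<kappa> / 2 * v x" using \<kappa>(1) v_pos[OF that(1)] by simp
    with a0(2)[OF that] show ?thesis by linarith
  qed
  have u_le: "u x \<le> \<kappa> * v x" if x: "x \<in> \<Omega>" for x
  proof (cases "a0 \<le> d x")
    case True
    with x x0(2)[of x] have "u x / v x \<le> \<kappa>" by (simp add: K0_def \<kappa>_def)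
    then show ?thesis using v_pos[OF x] by (simp add: pos_divide_le_eq)
  next
    case False
    then have "u x \<le> \<kappa> / 2 * v x" using near x by simp
    then show ?thesis using \<kappa>(2) v_pos[OF x] mult_pos_pos[of \<kappa> "v x"] by linarith
  qed

  \<comment> \<open>Choice of the compact sets and of the scales\<close>
  define a where "a = a0 / 2"
  \<comment> \<open>The first bound keeps the perturbed maximum out of the layer a \<le> d < a0. The
    second makes the error smaller than the gap \<kappa> / sqrt d of the barrier, which is at least
    \<kappa> / sqrt R.\<close>
  define \<eta> where "\<eta> = min (\<kappa> * barrier M a / 8) (\<kappa> / sqrt R)"
  have x0_\<Omega>: "x0 \<in> \<Omega>" "a0 \<le> d x0" using x0(1) by (auto simp: K0_def)
  have a: "0 < a" "a < a0" "a \<le> R" using a0(1) x0_\<Omega> d_le_R[OF x0_\<Omega>(1)] by (auto simp: a_def)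
  have barrier_a: "0 < barrier M a" "\<And>x. x \<in> \<Omega> \<Longrightarrow> a \<le> d x \<Longrightarrow> barrier M a \<le> v x"
    using barrier_pos_mono[OF R(1)] a d_le_R by (auto simp: M_def v_def)
  have "0 < \<eta>"
    using \<kappa>(2) barrier_a(1) R(1) by (simp add: \<eta>_def)
  moreover have "\<eta> \<le> \<kappa> * barrier M a / 8" "\<eta> \<le> \<kappa> / sqrt R"
    unfolding \<eta>_def by (rule min.cobounded1, rule min.cobounded2)
  ultimately have \<eta>: "0 < \<eta>" "\<eta> \<le> \<kappa> * barrier M a / 8" "\<eta> \<le> \<kappa> / sqrt R" .

  define K where "K = {x \<in> \<Omega>. a \<le> d x}"
  define K' where "K' = {x \<in> \<Omega>. a / 2 \<le> d x}"
  have K: "compact K" "compact K'" "K \<subseteq> \<Omega>" "K' \<subseteq> \<Omega>" "K \<subseteq> K'"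
    using compact_bdist_ge[OF \<Omega>(1,2), of a] compact_bdist_ge[OF \<Omega>(1,2), of "a / 2"] a(1)
    by (auto simp: K_def K'_def d_def)
  \<comment> \<open>The potential term in the tested inequality is the mollification of this
    quotient, which needs its own modulus of continuity.\<close>
  define f where "f x = u x / (d x)\<^sup>2" for x
  have f_cont: "continuous_on \<Omega> f"
    unfolding f_def using u by (intro continuous_intros) (auto dest: d_pos)
  have "uniformly_continuous_on K' u" "uniformly_continuous_on K' f"
    using K u f_cont by (auto intro!: compact_uniformly_continuous intro: continuous_on_subset)
  then obtain \<delta>1 \<delta>2 where \<delta>12: "0 < \<delta>1" "0 < \<delta>2"
    "\<And>x z. x \<in> K' \<Longrightarrow> z \<in> K' \<Longrightarrow> dist z x < \<delta>1 \<Longrightarrow> dist (u z) (u x) < \<eta>"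
    "\<And>x z. x \<in> K' \<Longrightarrow> z \<in> K' \<Longrightarrow> dist z x < \<delta>2 \<Longrightarrow> dist (f z) (f x) < \<eta>"
    using \<eta>(1) unfolding uniformly_continuous_on_def by metis
  \<comment> \<open>a / 4 keeps the closed balls centred in K inside K'; halving \<delta>1 and
    \<delta>2 turns non-strict distances into the strict ones required.\<close>
  define \<delta> where "\<delta> = min (a / 4) (min \<delta>1 \<delta>2 / 2)"
  have \<delta>: "0 < \<delta>" "\<delta> < a / 2" "\<delta> < \<delta>1" "\<delta> < \<delta>2"
    using a(1) \<delta>12(1,2) by (auto simp: \<delta>_def)
  have cball_K': "cball x \<delta> \<subseteq> K'" if x: "x \<in> K" for x
  proof
    fix z assume z: "z \<in> cball x \<delta>"
    have "z \<in> ball x (d x)" using z \<delta>(2) x a(1) by (auto simp: K_def)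
    then show "z \<in> K'"
      using d_ball[of x] x d_lip[of x z] z \<delta>(2) a(1) by (auto simp: K_def K'_def)
  qed
  have cball_\<Omega>: "cball x \<delta> \<subseteq> \<Omega>" if "x \<in> K" for x
    using cball_K'[OF that] K(4) by blast
  have close_u: "\<bar>u z - u x\<bar> \<le> \<eta>" and close_f: "\<bar>f z - f x\<bar> \<le> \<eta>" if "x \<in> K" "z \<in> cball x \<delta>" for x z
    using \<delta>12(3,4)[of x z] cball_K'[OF that(1)] that K(5) \<delta>(3,4)
    by (force simp: dist_real_def dist_commute)+

  \<comment> \<open>The perturbed maximum point\<close>
  define m where "m = (LINT x|lebesgue. bump \<delta> (0::'a) x)"
  have m: "0 < m" unfolding m_def by (rule bump_integral_pos[OF \<delta>(1)])
  have moll_u: "\<bar>mollify \<Omega> u \<delta> x - u x * m\<bar> \<le> \<eta> * m" if "x \<in> K" for x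
    unfolding m_def using \<delta>(1) cball_\<Omega>[OF that] close_u[OF that] by (intro mollify_approx[OF u]) auto
  have moll_f: "\<bar>mollify \<Omega> f \<delta> x - f x * m\<bar> \<le> \<eta> * m" if "x \<in> K" for x
    unfolding m_def using \<delta>(1) cball_\<Omega>[OF that] close_f[OF that] by (intro mollify_approx[OF f_cont]) auto

  define W where "W x = mollify \<Omega> u \<delta> x - m * \<kappa> * v x" for x
  have "continuous_on K W"
    unfolding W_def using \<delta>(1) cball_K' K(2-4) v_cont
    by (intro continuous_intros continuous_on_mollify[OF u _ K(2,4)]) (auto intro: continuous_on_subset)
  moreover have x0_K: "x0 \<in> K" using x0_\<Omega> a by (simp add: K_def)
  ultimately obtain y where y: "y \<in> K" "\<And>x. x \<in> K \<Longrightarrow> W x \<le> W y"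
    using continuous_attains_sup[OF K(1), of W] by auto
  have y_\<Omega>: "y \<in> \<Omega>" "a \<le> d y" using y(1) by (auto simp: K_def)
  \<comment> \<open>In the layer a \<le> d < a0 the reserve factor 1/2 gives W \<le> m (-4 \<eta> +
    \<eta>) = -3 \<eta> m, whereas W at \<open>x0\<close> is at least -\<eta> m. Hence y is not on
    the edge of K.\<close>
  have d_y: "a0 \<le> d y"
  proof (rule ccontr)
    assume "\<not> a0 \<le> d y"
    then have "u y \<le> \<kappa> / 2 * v y" using near y_\<Omega> by simp
    then have "m * (u y - \<kappa> * v y) \<le> m * (- (\<kappa> / 2 * v y))" using m by (intro mult_left_mono) auto
    also have "\<dots> \<le> m * (- (\<kappa> / 2 * barrier M a))"
      using m \<kappa>(2) barrier_a(2)[OF y_\<Omega>] by (intro mult_left_mono) auto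
    also have "\<dots> \<le> m * (- (4 * \<eta>))"
      using m \<eta>(2) by (intro mult_left_mono) auto
    finally have "W y \<le> - (3 * (\<eta> * m))"
      using moll_u[OF y(1)] by (simp add: W_def algebra_simps abs_le_iff)
    moreover have "W x0 \<ge> - (\<eta> * m)"
    proof -
      have "u x0 = \<kappa> * v x0" using v_pos[OF x0_\<Omega>(1)] by (simp add: \<kappa>_def)
      then show ?thesis using moll_u[OF x0_K] by (simp add: W_def algebra_simps abs_le_iff)
    qed
    ultimately show False
      using y(2)[OF x0_K] mult_pos_pos[OF \<eta>(1) m] by linarith
  qed

  \<comment> \<open>Contradiction at the maximum point\<close>
  define r where "r = min (a / 2) 1"
  \<comment> \<open>Both \<delta> and r are at most a / 2, the former strictly, so the kernels stay
    inside \<Omega>. As d(y) \<ge> a0 = 2 a, points within r of y still have distance at least a and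
    belong to K, where W y is maximal.\<close>
  have r: "0 < r" "\<delta> + r < d y" "r \<le> 1" "r \<le> a"
    using a \<delta>(2) d_y by (auto simp: r_def)
  have "(\<Sum>b\<in>Basis. LINT x:\<Omega>|lebesgue. u x * bump_partial2 \<delta> y b x) \<le> (m * \<kappa>) * barrier'' M (d y)"
    unfolding d_def
  proof (rule barrier_touching_inequality[OF \<Omega> R(1) R(2)[unfolded d_def] M_def u y_\<Omega>(1) _ r(1) r(2)[unfolded d_def] r(3)])
    show "0 \<le> \<delta>" "0 \<le> m * \<kappa>" using \<delta>(1) m \<kappa>(2) by auto
    fix z assume z: "dist y z \<le> r"
    then have "z \<in> ball y (d y)" using r \<delta>(1) by auto
    then have "z \<in> K"
      using d_ball[OF y_\<Omega>(1)] d_lip[of y z] z r(4) d_y by (auto simp: K_def a_def)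
    from y(2)[OF this]
    show "mollify \<Omega> u \<delta> z - m * \<kappa> * barrier M (bdist \<Omega> z) \<le> mollify \<Omega> u \<delta> y - m * \<kappa> * barrier M (bdist \<Omega> y)"
      by (simp add: W_def v_def d_def)
  qed
  moreover have "- (\<Sum>b\<in>Basis. LINT x:\<Omega>|lebesgue. u x * bump_partial2 \<delta> y b x) \<le> 1 / 4 * mollify \<Omega> f \<delta> y"
    using subharmonic_bump_inequality[OF \<Omega>(1) \<open>L_quarter_subharmonic \<Omega> u\<close> \<delta>(1) cball_\<Omega>[OF y(1)]]
    by (simp add: mollify_def f_def d_def)
  ultimately have "- ((m * \<kappa>) * barrier'' M (d y)) \<le> 1 / 4 * mollify \<Omega> f \<delta> y" by linarith
  also have "\<dots> \<le> 1 / 4 * ((f y + \<eta>) * m)"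
    using moll_f[OF y(1)] by (simp add: abs_le_iff algebra_simps)
  also have "\<dots> \<le> 1 / 4 * ((\<kappa> * v y / (d y)\<^sup>2 + \<eta>) * m)"
    using u_le[OF y_\<Omega>(1)] m by (auto simp: f_def intro!: mult_right_mono divide_right_mono)
  also have "\<dots> = m * (\<kappa> * v y / (4 * (d y)\<^sup>2) + \<eta> / 4)"
    by (simp add: field_simps)
  also have "- ((m * \<kappa>) * barrier'' M (d y)) = m * (\<kappa> * v y / (4 * (d y)\<^sup>2) + \<kappa> / sqrt (d y))"
    by (simp add: barrier''_def v_def algebra_simps)
  \<comment> \<open>The potential terms \<kappa> v / (4 d^2) agree on both sides and cancel; only
    the gap of the barrier and the mollification error remain.\<close>
  finally have "\<kappa> / sqrt (d y) \<le> \<eta> / 4" using m by simp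
  moreover have "\<kappa> / sqrt R \<le> \<kappa> / sqrt (d y)"
    using \<kappa>(2) d_pos[OF y_\<Omega>(1)] d_le_R[OF y_\<Omega>(1)] by (intro divide_left_mono) auto
  ultimately show False using \<eta>(1,3) by linarith
qed

end
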